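(* For every support $I\subset\{1,\dots,n\}$, $$\dim Q_I\le n-k-(|I|-r_I)\le n-k.$$ If $\dim Q_I=n-k$, then $r_I=|I|$ and $$M_I\otimes_{\mathbb Z}\mathbb C=\ker\mu_I .$$ Consequently the support weights $\Lambda_i$, $i\in I$, are linearly independent. With $W_I=\mathbb C^J/(M_I\otimes_{\mathbb Z}\mathbb C)$, the labelled classes of the standard basis vectors $e_j$ ($j\in J$) in $W_I$ determine the residual weight configuration $(\Lambda_j|_{\mathfrak h_I})_{j\in J}$ up to linear equivalence.
   Context: Let $\mathfrak g=\mathbb C^k$ and let $\Lambda_1,\dots,\Lambda_n\in\mathfrak g^*$ span $\mathfrak g^*$. For $I\subset\{1,\dots,n\}$ put $J=I^c$, $r_I=\dim\operatorname{Span}\{\Lambda_i:i\in I\}$, $\mathfrak h_I=\bigcap_{i\in I}\ker\Lambda_i$, and let $\mu_I:\mathbb C^J\to\mathfrak h_I^*$ be the linear map with $\mu_I(e_j)=\Lambda_j|_{\mathfrak h_I}$. Put $S_I=\{\alpha\in\mathbb N^J:\mu_I(\alpha)=0\}$ ($0\in\mathbb N$), $M_I=\operatorname{gp}(S_I)\subset\mathbb Z^J$ and $Q_I=\operatorname{Spec}\mathbb C[S_I]$. Two labelled configurations of vectors are linearly equivalent if a linear isomorphism between their spans carries each labelled vector to the one with the same label. *)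

theory Defs
  imports
    Complex_Main
    "HOL-Library.Function_Algebras"
    "HOL-Library.Poly_Mapping"
    "HOL-Library.Extended_Real"
    "HOL-Computational_Algebra.Group_Closure"
    "HOL-Algebra.Ideal"
    "HOL-Algebra.Module"
begin

section \<open>Complex vector spaces of functions\<close>

definition fscale :: "complex \<Rightarrow> ('a \<Rightarrow> complex) \<Rightarrow> 'a \<Rightarrow> complex" where
  "fscale c f = (\<lambda>x. c * f x)"

interpretation fs: vector_space "fscale :: complex \<Rightarrow> ('a \<Rightarrow> complex) \<Rightarrow> 'a \<Rightarrow> complex"
  by unfold_locales (auto simp: fscale_def fun_eq_iff algebra_simps)

text \<open>The space of complex vectors with coordinates labelled by \<open>A\<close>; vectors are extended
  by \<open>0\<close> outside \<open>A\<close>.\<close>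
definition coord_space :: "'i set \<Rightarrow> ('i \<Rightarrow> complex) set" where
  "coord_space A = {x. \<forall>i. i \<notin> A \<longrightarrow> x i = 0}"

definition std_basis :: "'i \<Rightarrow> 'i \<Rightarrow> complex" where
  "std_basis j = (\<lambda>i. if i = j then 1 else 0)"

text \<open>The dual of a subspace \<open>V\<close>. A linear functional on \<open>V\<close> is represented by its extension
  by \<open>0\<close> outside \<open>V\<close>, so that equality of functionals on \<open>V\<close> is equality of functions.\<close>
definition dual_space :: "('a \<Rightarrow> complex) set \<Rightarrow> (('a \<Rightarrow> complex) \<Rightarrow> complex) set" where
  "dual_space V = {f. (\<forall>x\<in>V. \<forall>y\<in>V. f (x + y) = f x + f y)
                    \<and> (\<forall>c. \<forall>x\<in>V. f (fscale c x) = c * f x)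
                    \<and> (\<forall>x. x \<notin> V \<longrightarrow> f x = 0)}"

definition restrict_functional ::
  "(('a \<Rightarrow> complex) \<Rightarrow> complex) \<Rightarrow> ('a \<Rightarrow> complex) set \<Rightarrow> ('a \<Rightarrow> complex) \<Rightarrow> complex" where
  "restrict_functional f V = (\<lambda>x. if x \<in> V then f x else 0)"


section \<open>Quotient spaces and linear equivalence of labelled configurations\<close>

definition complex_ring :: "complex ring" where
  "complex_ring = \<lparr>carrier = UNIV, mult = (*), one = 1, zero = 0, add = (+)\<rparr>"

text \<open>The fields \<open>mult\<close> and \<open>one\<close> of the record type of modules play no role for modules.\<close>
definition fun_module :: "('a \<Rightarrow> complex) set \<Rightarrow> (complex, 'a \<Rightarrow> complex) module" where
  "fun_module V = \<lparr>carrier = V, mult = undefined, one = undefined, zero = 0, add = (+),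
                   smult = fscale\<rparr>"

text \<open>Scalar multiplication sends the class of \<open>x\<close> to the class of \<open>c x\<close>; adding \<open>U\<close> to the
  set of multiples matters only for \<open>c = 0\<close>.\<close>
definition quot_module :: "(complex, 'a) module \<Rightarrow> 'a set \<Rightarrow> (complex, 'a set) module" where
  "quot_module V U = \<lparr>carrier = a_rcosets\<^bsub>V\<^esub> U, mult = undefined, one = undefined,
                      zero = U, add = set_add V,
                      smult = (\<lambda>c A. U <+>\<^bsub>V\<^esub> ((\<lambda>x. c \<odot>\<^bsub>V\<^esub> x) ` A))\<rparr>"

definition module_span :: "(complex, 'a) module \<Rightarrow> 'a set \<Rightarrow> 'a set" where
  "module_span V X = \<Inter> {N. submodule N complex_ring V \<and> X \<subseteq> N}"

definition lin_equivalent ::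
  "'i set \<Rightarrow> (complex, 'a) module \<Rightarrow> ('i \<Rightarrow> 'a) \<Rightarrow> (complex, 'b) module \<Rightarrow> ('i \<Rightarrow> 'b) \<Rightarrow> bool" where
  "lin_equivalent J V v W w \<longleftrightarrow>
     (\<exists>\<phi>. bij_betw \<phi> (module_span V (v ` J)) (module_span W (w ` J))
        \<and> (\<forall>x \<in> module_span V (v ` J). \<forall>y \<in> module_span V (v ` J).
              \<phi> (x \<oplus>\<^bsub>V\<^esub> y) = \<phi> x \<oplus>\<^bsub>W\<^esub> \<phi> y)
        \<and> (\<forall>c. \<forall>x \<in> module_span V (v ` J). \<phi> (c \<odot>\<^bsub>V\<^esub> x) = c \<odot>\<^bsub>W\<^esub> \<phi> x)
        \<and> (\<forall>j\<in>J. \<phi> (v j) = w j))"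


section \<open>Monoid algebras and the dimension of their spectra\<close>

text \<open>For a submonoid \<open>S\<close> this is the subring of the monoid algebra of the ambient monoid
  consisting of the elements supported in \<open>S\<close>; multiplication of finitely supported functions
  in the library is convolution.\<close>
definition monoid_algebra :: "'a::comm_monoid_add set \<Rightarrow> ('a \<Rightarrow>\<^sub>0 complex) ring" where
  "monoid_algebra S = \<lparr>carrier = {p. Poly_Mapping.keys p \<subseteq> S}, mult = (*), one = 1, zero = 0, add = (+)\<rparr>"

definition Spec :: "'a ring \<Rightarrow> 'a set set" where
  "Spec R = {P. primeideal P R}"

text \<open>Krull dimension; the value is \<open>-\<infinity>\<close> for an empty spectrum.\<close>
definition dim_Spec :: "'a ring \<Rightarrow> ereal" where
  "dim_Spec R = Sup {ereal (real d) | d :: nat.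
     \<exists>P. (\<forall>i\<le>d. P i \<in> Spec R) \<and> (\<forall>i<d. P i \<subset> P (Suc i))}"


section \<open>Weight configurations\<close>

definition spanning_weights :: "nat \<Rightarrow> nat \<Rightarrow> (nat \<Rightarrow> (nat \<Rightarrow> complex) \<Rightarrow> complex) \<Rightarrow> bool" where
  "spanning_weights k n \<Lambda> \<longleftrightarrow>
     (\<forall>i\<in>{1..n}. \<Lambda> i \<in> dual_space (coord_space {1..k})) \<and>
     fs.span (\<Lambda> ` {1..n}) = dual_space (coord_space {1..k})"

definition support_rank :: "(nat \<Rightarrow> (nat \<Rightarrow> complex) \<Rightarrow> complex) \<Rightarrow> nat set \<Rightarrow> nat" where
  "support_rank \<Lambda> I = fs.dim (fs.span (\<Lambda> ` I))"

definition common_kernel ::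
  "nat \<Rightarrow> (nat \<Rightarrow> (nat \<Rightarrow> complex) \<Rightarrow> complex) \<Rightarrow> nat set \<Rightarrow> (nat \<Rightarrow> complex) set" where
  "common_kernel k \<Lambda> I = {x \<in> coord_space {1..k}. \<forall>i\<in>I. \<Lambda> i x = 0}"

definition residual_weight ::
  "nat \<Rightarrow> (nat \<Rightarrow> (nat \<Rightarrow> complex) \<Rightarrow> complex) \<Rightarrow> nat set \<Rightarrow> nat \<Rightarrow> (nat \<Rightarrow> complex) \<Rightarrow> complex" where
  "residual_weight k \<Lambda> I j = restrict_functional (\<Lambda> j) (common_kernel k \<Lambda> I)"

definition residual_map ::
  "nat \<Rightarrow> nat \<Rightarrow> (nat \<Rightarrow> (nat \<Rightarrow> complex) \<Rightarrow> complex) \<Rightarrow> nat set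
     \<Rightarrow> (nat \<Rightarrow> complex) \<Rightarrow> (nat \<Rightarrow> complex) \<Rightarrow> complex" where
  "residual_map k n \<Lambda> I z = (\<Sum>j \<in> {1..n} - I. fscale (z j) (residual_weight k \<Lambda> I j))"

lemma residual_map_std_basis:
  assumes "j \<in> {1..n} - I"
  shows "residual_map k n \<Lambda> I (std_basis j) = residual_weight k \<Lambda> I j"
proof -
  have "residual_map k n \<Lambda> I (std_basis j)
      = (\<Sum>i \<in> {1..n} - I. if i = j then residual_weight k \<Lambda> I j else 0)"
    unfolding residual_map_def
    by (rule sum.cong) (auto simp: std_basis_def fscale_def fun_eq_iff)
  with assms show ?thesis by (simp add: sum.delta)
qed

definition residual_kernel ::
  "nat \<Rightarrow> nat \<Rightarrow> (nat \<Rightarrow> (nat \<Rightarrow> complex) \<Rightarrow> complex) \<Rightarrow> nat set \<Rightarrow> (nat \<Rightarrow> complex) set" where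
  "residual_kernel k n \<Lambda> I = {z \<in> coord_space ({1..n} - I). residual_map k n \<Lambda> I z = 0}"

definition invariant_monoid ::
  "nat \<Rightarrow> nat \<Rightarrow> (nat \<Rightarrow> (nat \<Rightarrow> complex) \<Rightarrow> complex) \<Rightarrow> nat set \<Rightarrow> (nat \<Rightarrow> nat) set" where
  "invariant_monoid k n \<Lambda> I =
     {\<alpha>. (\<forall>j. j \<notin> {1..n} - I \<longrightarrow> \<alpha> j = 0) \<and> residual_map k n \<Lambda> I (\<lambda>j. of_nat (\<alpha> j)) = 0}"

definition invariant_lattice ::
  "nat \<Rightarrow> nat \<Rightarrow> (nat \<Rightarrow> (nat \<Rightarrow> complex) \<Rightarrow> complex) \<Rightarrow> nat set \<Rightarrow> (nat \<Rightarrow> int) set" where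
  "invariant_lattice k n \<Lambda> I = group_closure ((\<lambda>\<alpha> j. int (\<alpha> j)) ` invariant_monoid k n \<Lambda> I)"

text \<open>Since the complex numbers are flat over the integers, the complexification of a subgroup
  of the integer vectors embeds into the space of complex vectors; it is identified with its
  image, the complex span of the subgroup.\<close>
definition invariant_lattice_complex ::
  "nat \<Rightarrow> nat \<Rightarrow> (nat \<Rightarrow> (nat \<Rightarrow> complex) \<Rightarrow> complex) \<Rightarrow> nat set \<Rightarrow> (nat \<Rightarrow> complex) set" where
  "invariant_lattice_complex k n \<Lambda> I =
     fs.span ((\<lambda>m j. of_int (m j)) ` invariant_lattice k n \<Lambda> I)"

definition dim_Q :: "nat \<Rightarrow> nat \<Rightarrow> (nat \<Rightarrow> (nat \<Rightarrow> complex) \<Rightarrow> complex) \<Rightarrow> nat set \<Rightarrow> ereal" where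
  "dim_Q k n \<Lambda> I = dim_Spec (monoid_algebra (invariant_monoid k n \<Lambda> I))"

definition residual_dual ::
  "nat \<Rightarrow> (nat \<Rightarrow> (nat \<Rightarrow> complex) \<Rightarrow> complex) \<Rightarrow> nat set
     \<Rightarrow> (complex, (nat \<Rightarrow> complex) \<Rightarrow> complex) module" where
  "residual_dual k \<Lambda> I = fun_module (dual_space (common_kernel k \<Lambda> I))"

definition quotient_W ::
  "nat \<Rightarrow> nat \<Rightarrow> (nat \<Rightarrow> (nat \<Rightarrow> complex) \<Rightarrow> complex) \<Rightarrow> nat set
     \<Rightarrow> (complex, (nat \<Rightarrow> complex) set) module" where
  "quotient_W k n \<Lambda> I =
     quot_module (fun_module (coord_space ({1..n} - I))) (invariant_lattice_complex k n \<Lambda> I)"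

definition basis_class ::
  "nat \<Rightarrow> nat \<Rightarrow> (nat \<Rightarrow> (nat \<Rightarrow> complex) \<Rightarrow> complex) \<Rightarrow> nat set \<Rightarrow> nat \<Rightarrow> (nat \<Rightarrow> complex) set" where
  "basis_class k n \<Lambda> I j =
     invariant_lattice_complex k n \<Lambda> I +>\<^bsub>fun_module (coord_space ({1..n} - I))\<^esub> std_basis j"

end

theory Submission
  imports Defs
begin

text \<open>
  If \<open>P\<^sub>0 \<subset> \<dots> \<subset> P\<^sub>d\<close> are primes of the monoid algebra and \<open>x\<^sub>i\<close> lies in the
  next prime of the chain but not in \<open>P\<^sub>i\<close>, then the \<open>d\<close> elements \<open>x\<^sub>i\<close> are algebraically
  independent. The \<open>(N + 1)\<^sup>d\<close> monomials in them with exponents at most \<open>N\<close> are supported in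
  the points of \<open>S\<^sub>I\<close> in a cube of side \<open>O(N)\<close>. There are only \<open>O(N\<^sup>r)\<close> such points, where
  \<open>r\<close> is the dimension of the complex span of \<open>S\<^sub>I\<close>, because \<open>r\<close> suitable coordinates
  determine a vector of the span. Hence \<open>dim Q\<^sub>I \<le> r\<close>.

  The span lies in the kernel of \<open>\<mu>\<^sub>I\<close>, whose dimension is at most \<open>|J| - (k - r\<^sub>I)\<close>. If
  \<open>dim Q\<^sub>I = n - k\<close>, all these inequalities are equalities, so the span is the whole kernel,
  and \<open>\<mu>\<^sub>I\<close> induces an isomorphism of \<open>W\<^sub>I\<close> onto the span of the residual weights.
\<close>

section \<open>Subspaces of coordinate spaces\<close>

interpretation fp: vector_space_pair
  "fscale :: complex \<Rightarrow> ('a \<Rightarrow> complex) \<Rightarrow> 'a \<Rightarrow> complex"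
  "fscale :: complex \<Rightarrow> ('b \<Rightarrow> complex) \<Rightarrow> 'b \<Rightarrow> complex"
  by unfold_locales

lemma sum_fun_apply: "(\<Sum>a\<in>A. f a) x = (\<Sum>a\<in>A. f a x)" for f :: "'a \<Rightarrow> 'b \<Rightarrow> 'c::comm_monoid_add"
  by (induction A rule: infinite_finite_induct) auto

text \<open>Independence in the library is a property of sets, which ignores repetitions.
  Injectivity is recorded along with it so that the size of the index set can be counted; two equal
  members would give a relation with coefficients 1 and -1.\<close>

lemma independent_family:
  assumes "finite F"
    and "\<And>c. (\<Sum>a\<in>F. fscale (c a) (v a)) = 0 \<Longrightarrow> \<forall>a\<in>F. c a = 0"
  shows "inj_on v F \<and> fs.independent (v ` F)"
proof
  show inj: "inj_on v F"
  proof (rule inj_onI, rule ccontr)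
    fix a b assume ab: "a \<in> F" "b \<in> F" "v a = v b" "a \<noteq> b"
    define c :: "'a \<Rightarrow> complex" where "c = (\<lambda>x. if x = a then 1 else if x = b then -1 else 0)"
    have "(\<Sum>x\<in>F. fscale (c x) (v x))
        = (\<Sum>x\<in>F. (if x = a then v a else 0) + (if x = b then - v a else 0))"
      using ab by (intro sum.cong refl) (auto simp: c_def fscale_def fun_eq_iff)
    also have "\<dots> = 0"
      using ab assms(1) by (simp add: sum.distrib sum.delta)
    finally have "c a = 0" using assms(2) ab by blast
    then show False by (simp add: c_def)
  qed
  show "fs.independent (v ` F)"
    unfolding fs.dependent_finite[OF finite_imageI[OF assms(1)]]
  proof safe
    fix u a
    assume u: "(\<Sum>w\<in>v ` F. fscale (u w) w) = 0" and a: "a \<in> F" "u (v a) \<noteq> 0"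
    from u have "(\<Sum>a\<in>F. fscale (u (v a)) (v a)) = 0"
      by (simp add: sum.reindex[OF inj])
    from assms(2)[OF this] a show False by blast
  qed
qed

lemma subspace_coord_space: "fs.subspace (coord_space A)"
  by (auto simp: fs.subspace_def coord_space_def fscale_def)

lemma coord_space_expand:
  assumes "finite A" "x \<in> coord_space A"
  shows "x = (\<Sum>i\<in>A. fscale (x i) (std_basis i))"
  using assms
  by (auto simp: fun_eq_iff sum_fun_apply fscale_def std_basis_def coord_space_def
      if_distrib sum.delta' cong: if_cong)

lemma coord_space_eq_span:
  assumes "finite A"
  shows "coord_space A = fs.span (std_basis ` A)"
proof
  show "coord_space A \<subseteq> fs.span (std_basis ` A)"
  proof
    fix x assume "x \<in> coord_space A"
    then have "x = (\<Sum>i\<in>A. fscale (x i) (std_basis i))" by (rule coord_space_expand[OF assms])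
    then show "x \<in> fs.span (std_basis ` A)"
      by (metis (no_types, lifting) fs.span_base fs.span_scale fs.span_sum imageI)
  qed
  show "fs.span (std_basis ` A) \<subseteq> coord_space A"
    by (rule fs.span_minimal[OF _ subspace_coord_space])
      (auto simp: coord_space_def std_basis_def)
qed

lemma independent_card_le_coords:
  assumes "finite A" "fs.independent C" "C \<subseteq> coord_space A"
  shows "finite C \<and> card C \<le> card A"
proof -
  have "finite C \<and> card C \<le> card (std_basis ` A :: ('a \<Rightarrow> complex) set)"
    using assms by (intro fs.independent_span_bound) (auto simp: coord_space_eq_span[symmetric])
  then show ?thesis using card_image_le[OF assms(1), of std_basis] by force
qed

text \<open>The finite spanning set \<open>T\<close> excludes the default value 0 that
  \<open>fs.dim\<close> takes on infinite-dimensional spaces.\<close>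

lemma independent_card_le_dim:
  assumes "finite T" "V \<subseteq> fs.span T" "fs.independent C" "C \<subseteq> V"
  shows "finite C \<and> card C \<le> fs.dim V"
proof -
  obtain B where B: "B \<subseteq> V" "fs.independent B" "V \<subseteq> fs.span B" "card B = fs.dim V"
    using fs.basis_exists[of V] by blast
  have "finite B" using fs.independent_span_bound[OF assms(1) B(2)] B(1) assms(2) by blast
  then show ?thesis using fs.independent_span_bound[of B C] B assms by auto
qed

text \<open>A vector of \<open>V\<close> outside \<open>U\<close> would extend a basis of
  \<open>U\<close> to an independent subset of \<open>V\<close> with more than
  \<open>fs.dim V\<close> elements.\<close>

lemma subspace_eq_if_dim_le:
  assumes "finite T" "V \<subseteq> fs.span T" "fs.subspace U" "U \<subseteq> V" "fs.dim V \<le> fs.dim U"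
  shows "U = V"
proof (rule ccontr)
  assume "U \<noteq> V"
  then obtain x where x: "x \<in> V" "x \<notin> U" using assms by blast
  obtain B where B: "B \<subseteq> U" "fs.independent B" "U \<subseteq> fs.span B" "card B = fs.dim U"
    using fs.basis_exists[of U] by blast
  have eq: "fs.span B = U" using B assms(3) by (simp add: fs.span_minimal subset_antisym)
  have "finite B" using independent_card_le_dim[OF assms(1,2) B(2)] B(1) assms(4) by blast
  have "fs.independent (insert x B)" using B x eq by (simp add: fs.independent_insertI)
  then have "card (insert x B) \<le> fs.dim V"
    using independent_card_le_dim[OF assms(1,2)] B x assms by blast
  moreover have "x \<notin> B" using x B by blast
  ultimately show False using \<open>finite B\<close> B assms(5) by simp
qed

section \<open>Sets of coordinates that determine the vectors of a subspace\<close>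

lemma dim_le_card_if_restriction_injective:
  assumes "fs.subspace V" "finite R"
    and "\<And>v. \<lbrakk>v \<in> V; \<forall>j\<in>R. v j = 0\<rbrakk> \<Longrightarrow> v = 0"
  shows "fs.dim V \<le> card R"
proof -
  define \<rho> :: "('a \<Rightarrow> complex) \<Rightarrow> 'a \<Rightarrow> complex" where "\<rho> = (\<lambda>v j. if j \<in> R then v j else 0)"
  have lin: "Vector_Spaces.linear fscale fscale \<rho>"
    by (auto simp: Vector_Spaces.linear_iff fs.vector_space_axioms \<rho>_def fscale_def fun_eq_iff)
  obtain B where B: "B \<subseteq> V" "fs.independent B" "V \<subseteq> fs.span B" "card B = fs.dim V"
    using fs.basis_exists[of V] by blast
  have eq: "fs.span B = V" using B assms(1) by (simp add: fs.span_minimal subset_antisym)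
  have inj: "inj_on \<rho> (fs.span B)"
    unfolding eq
  proof (rule inj_onI)
    fix x y assume xy: "x \<in> V" "y \<in> V" "\<rho> x = \<rho> y"
    have "x - y = 0"
    proof (rule assms(3))
      show "x - y \<in> V" using xy assms(1) by (simp add: fs.subspace_diff)
      show "\<forall>j\<in>R. (x - y) j = 0"
        using xy(3) by (auto simp: \<rho>_def fun_eq_iff) (metis)
    qed
    then show "x = y" by simp
  qed
  have "fs.independent (\<rho> ` B)"
    by (rule fp.linear_independent_injective_image[OF lin B(2) inj])
  then have "card (\<rho> ` B) \<le> card R"
    by (intro conjunct2[OF independent_card_le_coords[OF assms(2)]])
      (auto simp: \<rho>_def coord_space_def)
  moreover have "inj_on \<rho> B" using inj fs.span_superset inj_on_subset by blast
  ultimately show ?thesis using B by (simp add: card_image)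
qed

text \<open>Take \<open>R\<close> of least size among the sets of coordinates that determine the
  vectors of \<open>V\<close>. Removing i from \<open>R\<close> destroys this property, so
  \<open>V\<close> contains a vector that vanishes on \<open>R - {i}\<close> but not at i. These
  vectors are independent, one for each i, which bounds the size of \<open>R\<close> by the
  dimension.\<close>

lemma restriction_injective_subset:
  assumes "fs.subspace V" "finite J" "V \<subseteq> coord_space J"
  obtains R where "R \<subseteq> J" "card R \<le> fs.dim V"
    "\<And>v. \<lbrakk>v \<in> V; \<forall>j\<in>R. v j = 0\<rbrakk> \<Longrightarrow> v = 0"
proof -
  define ok where "ok = (\<lambda>R. R \<subseteq> J \<and> (\<forall>v\<in>V. (\<forall>j\<in>R. v j = 0) \<longrightarrow> v = 0))"
  have "ok J" using assms(3) by (auto simp: ok_def coord_space_def fun_eq_iff)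
  then obtain R where R: "ok R" and min: "\<And>R'. ok R' \<Longrightarrow> card R \<le> card R'"
    using arg_min_nat_lemma[of ok J card] by blast
  have fin: "finite R" using R assms(2) by (auto simp: ok_def finite_subset)
  have "\<exists>v\<in>V. (\<forall>j\<in>R - {i}. v j = 0) \<and> v i \<noteq> 0" if "i \<in> R" for i
  proof -
    have "\<not> ok (R - {i})" using min[of "R - {i}"] that fin card_Diff1_less[of R i] by force
    then obtain v where v: "v \<in> V" "\<forall>j\<in>R - {i}. v j = 0" "v \<noteq> 0"
      using R by (auto simp: ok_def)
    then have "v i \<noteq> 0" using R by (auto simp: ok_def)
    then show ?thesis using v by blast
  qed
  then obtain w where w: "\<And>i. i \<in> R \<Longrightarrow> w i \<in> V \<and> (\<forall>j\<in>R - {i}. w i j = 0) \<and> w i i \<noteq> 0"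
    by metis
  have ind: "inj_on w R \<and> fs.independent (w ` R)"
  proof (rule independent_family[OF fin], intro ballI)
    fix c a assume "(\<Sum>i\<in>R. fscale (c i) (w i)) = 0" and a: "a \<in> R"
    then have "(\<Sum>i\<in>R. c i * w i a) = 0"
      by (simp add: fun_eq_iff sum_fun_apply fscale_def)
    moreover have "(\<Sum>i\<in>R. c i * w i a) = (\<Sum>i\<in>R. if i = a then c a * w a a else 0)"
      using a w by (intro sum.cong) auto
    ultimately show "c a = 0" using a fin w by (simp add: sum.delta)
  qed
  have "card (w ` R) \<le> fs.dim V"
    by (rule conjunct2[OF independent_card_le_dim[of "std_basis ` J"]])
      (use ind w assms in \<open>auto simp: coord_space_eq_span[symmetric]\<close>)
  then have "card R \<le> fs.dim V" using ind by (simp add: card_image)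
  then show thesis using that[of R] R by (auto simp: ok_def)
qed

section \<open>Chains of primes in monoid algebras\<close>

definition bounded_exponents :: "'i set \<Rightarrow> nat \<Rightarrow> (('i \<Rightarrow> nat) \<Rightarrow>\<^sub>0 complex) \<Rightarrow> bool" where
  "bounded_exponents J b p \<longleftrightarrow> (\<forall>\<beta>\<in>Poly_Mapping.keys p. \<forall>j\<in>J. \<beta> j \<le> b)"

lemma bounded_exponents_mult:
  assumes "bounded_exponents J b p" "bounded_exponents J b' q"
  shows "bounded_exponents J (b + b') (p * q)"
  using assms keys_mult[of p q] by (fastforce simp: bounded_exponents_def intro: add_mono)

lemma bounded_exponents_one: "bounded_exponents J b 1"
  by (simp add: bounded_exponents_def)

lemma bounded_exponents_power:
  "bounded_exponents J b p \<Longrightarrow> bounded_exponents J (t * b) (p ^ t)"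
  by (induction t) (simp_all add: bounded_exponents_one bounded_exponents_mult)

lemma bounded_exponents_mono:
  "bounded_exponents J b p \<Longrightarrow> b \<le> b' \<Longrightarrow> bounded_exponents J b' p"
  by (force simp: bounded_exponents_def)

lemma ex_bounded_exponents:
  assumes "finite J" "finite A"
  shows "\<exists>b. \<forall>i\<in>A. bounded_exponents J b (x i)"
proof -
  let ?B = "(\<lambda>(\<beta>, j). \<beta> j) ` ((\<Union>i\<in>A. Poly_Mapping.keys (x i)) \<times> J)"
  have "finite ?B" using assms by auto
  \<comment> \<open>For empty \<open>?B\<close> the value of \<open>Max ?B\<close> is unspecified,
    but then there is nothing to bound.\<close>
  then have "\<forall>m\<in>?B. m \<le> Max ?B" by simp
  then have "\<forall>i\<in>A. bounded_exponents J (Max ?B) (x i)"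
    unfolding bounded_exponents_def by fastforce
  then show ?thesis by blast
qed

section \<open>The algebra of a submonoid and its prime ideals\<close>

locale exponent_monoid =
  fixes S :: "'a::comm_monoid_add set"
  assumes zero_mem: "0 \<in> S" and add_mem: "\<And>a b. \<lbrakk>a \<in> S; b \<in> S\<rbrakk> \<Longrightarrow> a + b \<in> S"
begin

abbreviation "alg \<equiv> carrier (monoid_algebra S)"

lemma alg_iff: "p \<in> alg \<longleftrightarrow> Poly_Mapping.keys p \<subseteq> S"
  by (simp add: monoid_algebra_def)

lemma alg_const: "Poly_Mapping.single 0 c \<in> alg"
  using zero_mem by (simp add: alg_iff)

lemma alg_one: "1 \<in> alg"
  using alg_const[of 1] by simp

lemma alg_mult: "p \<in> alg \<Longrightarrow> q \<in> alg \<Longrightarrow> p * q \<in> alg"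
  using keys_mult[of p q] add_mem by (fastforce simp: alg_iff)

lemma alg_add: "p \<in> alg \<Longrightarrow> q \<in> alg \<Longrightarrow> p + q \<in> alg"
  using keys_add[of p q] by (fastforce simp: alg_iff)

lemma alg_sum: "(\<And>i. i \<in> A \<Longrightarrow> f i \<in> alg) \<Longrightarrow> sum f A \<in> alg"
  by (induction A rule: infinite_finite_induct) (simp_all add: alg_add, simp_all add: alg_iff)

lemma alg_power: "p \<in> alg \<Longrightarrow> p ^ t \<in> alg"
  by (induction t) (simp_all add: alg_one alg_mult)

text \<open>Translates prime ideals of the record \<open>monoid_algebra S\<close> into the
  arithmetic of the type of finitely supported functions, in which all later computations take
  place.\<close>

lemma
  assumes "P \<in> Spec (monoid_algebra S)"
  shows prime_subset: "P \<subseteq> alg"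
    and prime_zero: "0 \<in> P"
    and prime_add: "\<And>p q. \<lbrakk>p \<in> P; q \<in> P\<rbrakk> \<Longrightarrow> p + q \<in> P"
    and prime_mult: "\<And>p q. \<lbrakk>p \<in> P; q \<in> alg\<rbrakk> \<Longrightarrow> p * q \<in> P"
    and prime_prime: "\<And>p q. \<lbrakk>p \<in> alg; q \<in> alg; p * q \<in> P\<rbrakk> \<Longrightarrow> p \<in> P \<or> q \<in> P"
    and prime_one: "1 \<notin> P"
proof -
  interpret primeideal P "monoid_algebra S" using assms by (simp add: Spec_def)
  show "P \<subseteq> alg" using a_subset by simp
  show "0 \<in> P" using additive_subgroup.zero_closed[OF is_additive_subgroup]
    by (simp add: monoid_algebra_def)
  show "p + q \<in> P" if "p \<in> P" "q \<in> P" for p q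
    using additive_subgroup.a_closed[OF is_additive_subgroup that] by (simp add: monoid_algebra_def)
  show mult: "p * q \<in> P" if "p \<in> P" "q \<in> alg" for p q
    using I_r_closed[OF that] by (simp add: monoid_algebra_def)
  show "p \<in> P \<or> q \<in> P" if "p \<in> alg" "q \<in> alg" "p * q \<in> P" for p q
    using I_prime[OF that(1,2)] that(3) by (simp add: monoid_algebra_def)
  show "1 \<notin> P"
  proof
    assume "1 \<in> P"
    then have "alg \<subseteq> P" using mult by force
    then show False using I_notcarr a_subset by blast
  qed
qed

lemma prime_diff:
  assumes "P \<in> Spec (monoid_algebra S)" "p + q \<in> P" "q \<in> P"
  shows "p \<in> P"
proof -
  \<comment> \<open>\<open>P\<close> is known to absorb products with elements of
    \<open>alg\<close>, so negation is multiplication by the constant -1.\<close>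
  have "q * Poly_Mapping.single 0 (-1) \<in> P" by (rule prime_mult[OF assms(1,3) alg_const])
  moreover have "Poly_Mapping.single 0 (-1) = (-1 :: 'a \<Rightarrow>\<^sub>0 complex)"
    by (simp add: single_uminus)
  ultimately have "(p + q) + (- q) \<in> P" by (intro prime_add[OF assms(1,2)]) simp
  moreover have "(p + q) + (- q) = p" by simp
  ultimately show ?thesis by simp
qed

text \<open>The coefficients \<open>u t\<close> will be polynomials in the later elements of the chain, for which
  \<open>u t \<in> Q\<close> forces \<open>u t = 0\<close> by the induction hypothesis; the lowest term of the sum is then removed
  by dividing by \<open>x\<close> modulo \<open>P\<close>.\<close>
lemma coefficients_zero:
  assumes P: "P \<in> Spec (monoid_algebra S)" and Q: "Q \<in> Spec (monoid_algebra S)"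
    and sub: "P \<subseteq> Q" and x: "x \<in> Q" "x \<notin> P"
    and "\<And>t. u t \<in> alg" and "\<And>t. t \<le> N \<Longrightarrow> u t \<in> Q \<Longrightarrow> u t = 0"
    and "(\<Sum>t\<le>N. x ^ t * u t) \<in> P"
  shows "t \<le> N \<Longrightarrow> u t = 0"
  using assms(6-)
proof (induction N arbitrary: u t)
  case 0
  then show ?case using sub by auto
next
  case (Suc N)
  have xA: "x \<in> alg" using prime_subset[OF Q] x by blast
  define v where "v = (\<Sum>t\<le>N. x ^ t * u (Suc t))"
  have vA: "v \<in> alg" unfolding v_def by (intro alg_sum alg_mult alg_power xA Suc.prems)
  have "(\<Sum>t\<le>Suc N. x ^ t * u t) = u 0 + x * v"
    unfolding v_def by (subst sum.atMost_Suc_shift) (simp add: sum_distrib_left mult.assoc)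
  then have mem: "u 0 + x * v \<in> P" using Suc.prems by simp
  \<comment> \<open>Modulo \<open>Q\<close> the element \<open>x\<close> vanishes, so only the
    lowest coefficient remains.\<close>
  then have "u 0 \<in> Q" using sub prime_diff[OF Q] prime_mult[OF Q x(1) vA] by blast
  then have u0: "u 0 = 0" using Suc.prems by simp
  then have "v \<in> P" using mem x prime_prime[OF P xA vA] by simp
  then have "u (Suc s) = 0" if "s \<le> N" for s
    using that Suc.prems by (intro Suc.IH[of s "\<lambda>t. u (Suc t)"]) (auto simp: v_def)
  then show ?case using u0 Suc.prems(1) by (cases t) auto
qed

end

section \<open>Algebraic independence along a chain of primes\<close>

text \<open>Exponents form a list and the index of the first variable moves along, so that induction
  on the list splits off the element belonging to the smallest prime.\<close>

fun monomial_from :: "(nat \<Rightarrow> 'r::comm_semiring_1) \<Rightarrow> nat \<Rightarrow> nat list \<Rightarrow> 'r" where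
  "monomial_from x l [] = 1"
| "monomial_from x l (t # ts) = x l ^ t * monomial_from x (Suc l) ts"

lemma bounded_exponents_monomial:
  assumes "\<forall>i\<in>{l..<l + length ts}. bounded_exponents J b (x i)" "set ts \<subseteq> {..N}"
  shows "bounded_exponents J (length ts * (N * b)) (monomial_from x l ts)"
  using assms
proof (induction ts arbitrary: l)
  case (Cons t ts)
  have "bounded_exponents J (t * b) (x l ^ t)"
    using Cons.prems by (intro bounded_exponents_power) auto
  then have "bounded_exponents J (N * b) (x l ^ t)"
    using Cons.prems by (elim bounded_exponents_mono) auto
  moreover have "bounded_exponents J (length ts * (N * b)) (monomial_from x (Suc l) ts)"
    using Cons.prems by (intro Cons.IH) auto
  ultimately show ?case by (auto simp: add.commute dest: bounded_exponents_mult)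
qed (simp add: bounded_exponents_one)

context exponent_monoid begin

lemma alg_monomial:
  "\<forall>i\<in>{l..<l + length ts}. x i \<in> alg \<Longrightarrow> monomial_from x l ts \<in> alg"
  by (induction ts arbitrary: l) (auto intro!: alg_one alg_mult alg_power)

text \<open>Induction on the number of variables. Collect the relation by powers of
  \<open>x l\<close>. The coefficients are polynomials in the later elements, and the induction
  hypothesis says that such a polynomial lies in \<open>P (Suc l)\<close> only if all its scalar
  coefficients are 0. Hence \<open>coefficients_zero\<close> applies with the primes
  \<open>P l\<close> and \<open>P (Suc l)\<close>. The relation is taken modulo \<open>P l\<close>,
  not as an equation, because this is the form that the induction consumes.\<close>

lemma monomials_independent_mod_prime:
  fixes c :: "nat list \<Rightarrow> complex"
  assumes "\<forall>i\<le>l + m. P i \<in> Spec (monoid_algebra S)" "\<forall>i<l + m. P i \<subset> P (Suc i)"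
    and "\<forall>i<l + m. x i \<in> P (Suc i) - P i"
    and "(\<Sum>ts\<in>{ts. set ts \<subseteq> {..N} \<and> length ts = m}.
            Poly_Mapping.single 0 (c ts) * monomial_from x l ts) \<in> P l"
    and "set ts \<subseteq> {..N}" "length ts = m"
  shows "c ts = 0"
  using assms
proof (induction m arbitrary: l c ts)
  case 0
  have "{ts. set ts \<subseteq> {..N} \<and> length ts = 0} = {[]}" by auto
  with 0 have mem: "Poly_Mapping.single 0 (c []) \<in> P l" and P: "P l \<in> Spec (monoid_algebra S)"
    by (simp_all del: length_0_conv)
  show ?case
  proof (rule ccontr)
    assume "c ts \<noteq> 0"
    \<comment> \<open>Without variables the relation is a constant; a nonzero constant is a unit and
      cannot lie in a proper ideal.\<close>
    then have "Poly_Mapping.single 0 (c []) * Poly_Mapping.single 0 (inverse (c [])) = (1 :: 'a \<Rightarrow>\<^sub>0 complex)"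
      using 0 by (simp add: mult_single)
    then show False using prime_mult[OF P mem alg_const] prime_one[OF P] by metis
  qed
next
  case (Suc m)
  let ?F = "{ts. set ts \<subseteq> {..N} \<and> length ts = m}"
  let ?term = "\<lambda>l c ts. Poly_Mapping.single 0 (c ts) * monomial_from x l ts"
  \<comment> \<open>This is the coefficient of the power \<open>x l ^ t\<close>.\<close>
  define u where "u t = (\<Sum>ts\<in>?F. ?term (Suc l) (\<lambda>ts. c (t # ts)) ts)" for t
  have xA: "x i \<in> alg" if "i < l + Suc m" for i
    using Suc.prems that prime_subset[of "P (Suc i)"] by auto
  have eq: "{ts. set ts \<subseteq> {..N} \<and> length ts = Suc m} = (\<lambda>(t, ts). t # ts) ` ({..N} \<times> ?F)"
    by (auto simp: length_Suc_conv image_iff)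
  have inj: "inj_on (\<lambda>(t, ts). t # ts) ({..N} \<times> ?F)" by (auto intro: inj_onI)
  have "(\<Sum>ts\<in>{ts. set ts \<subseteq> {..N} \<and> length ts = Suc m}. ?term l c ts)
      = (\<Sum>(t, ts)\<in>{..N} \<times> ?F. ?term l c (t # ts))"
    unfolding eq sum.reindex[OF inj] by (intro sum.cong) auto
  also have "\<dots> = (\<Sum>t\<le>N. x l ^ t * u t)"
    unfolding u_def sum.cartesian_product[symmetric] sum_distrib_left
    by (intro sum.cong refl) (simp add: mult_ac)
  finally have mem: "(\<Sum>t\<le>N. x l ^ t * u t) \<in> P l" using Suc.prems by simp
  have zero: "c (t # ts) = 0" if "u t \<in> P (Suc l)" "ts \<in> ?F" for t ts
    using Suc.IH[of "Suc l" "\<lambda>ts. c (t # ts)" ts] Suc.prems that unfolding u_def by simp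
  have u0: "u t = 0" if "t \<le> N" for t
  proof (rule coefficients_zero[OF _ _ _ _ _ _ _ mem that])
    show "P l \<in> Spec (monoid_algebra S)" "P (Suc l) \<in> Spec (monoid_algebra S)" "P l \<subseteq> P (Suc l)"
      "x l \<in> P (Suc l)" "x l \<notin> P l"
      using Suc.prems by (simp_all add: psubset_imp_subset)
    show "u t \<in> alg" for t
      unfolding u_def by (intro alg_sum alg_mult alg_const alg_monomial) (auto intro!: xA)
    show "u t = 0" if "u t \<in> P (Suc l)" for t
      using zero[OF that] unfolding u_def by (intro sum.neutral) simp
  qed
  \<comment> \<open>The equation \<open>u t = 0\<close> is read as membership in
    \<open>P (Suc l)\<close>, so that the induction hypothesis turns it into the vanishing of the
    scalars.\<close>
  have "0 \<in> P (Suc l)" using Suc.prems by (intro prime_zero) simp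
  then have "u t \<in> P (Suc l)" if "t \<le> N" for t using u0[OF that] by simp
  moreover obtain t ts' where "ts = t # ts'" "t \<le> N" "ts' \<in> ?F"
    using Suc.prems by (auto simp: length_Suc_conv)
  ultimately show ?case using zero by blast
qed

end

section \<open>Counting exponents and bounding the length of chains\<close>

text \<open>At most \<open>fs.dim V\<close> coordinates determine a vector of \<open>V\<close>, and
  each of them takes one of the \<open>Suc B\<close> values from 0 to \<open>B\<close>.\<close>

lemma card_bounded_exponent_vectors:
  fixes S :: "('i \<Rightarrow> nat) set"
  assumes J: "finite J" and S: "\<And>\<alpha> j. \<alpha> \<in> S \<Longrightarrow> j \<notin> J \<Longrightarrow> \<alpha> j = 0"
    and V: "fs.subspace V" "V \<subseteq> coord_space J" "\<And>\<alpha>. \<alpha> \<in> S \<Longrightarrow> (\<lambda>j. of_nat (\<alpha> j)) \<in> V"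
  shows "finite {\<alpha> \<in> S. \<forall>j\<in>J. \<alpha> j \<le> B} \<and> card {\<alpha> \<in> S. \<forall>j\<in>J. \<alpha> j \<le> B} \<le> Suc B ^ fs.dim V"
proof -
  let ?T = "{\<alpha> \<in> S. \<forall>j\<in>J. \<alpha> j \<le> B}"
  obtain R where R: "R \<subseteq> J" "card R \<le> fs.dim V"
    "\<And>v. \<lbrakk>v \<in> V; \<forall>j\<in>R. v j = 0\<rbrakk> \<Longrightarrow> v = 0"
    using restriction_injective_subset[OF V(1) J V(2)] by metis
  have finR: "finite R" using R(1) J by (rule finite_subset)
  have inj: "inj_on (\<lambda>\<alpha>. restrict \<alpha> R) ?T"
  proof (rule inj_onI)
    fix \<alpha> \<beta> assume ab: "\<alpha> \<in> ?T" "\<beta> \<in> ?T" "restrict \<alpha> R = restrict \<beta> R"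
    have "(\<lambda>j. of_nat (\<alpha> j)) - (\<lambda>j. of_nat (\<beta> j)) = (0 :: 'i \<Rightarrow> complex)"
    proof (rule R(3))
      show "(\<lambda>j. of_nat (\<alpha> j)) - (\<lambda>j. of_nat (\<beta> j)) \<in> V"
        using ab V by (intro fs.subspace_diff) auto
      show "\<forall>j\<in>R. ((\<lambda>j. of_nat (\<alpha> j)) - (\<lambda>j. of_nat (\<beta> j))) j = (0 :: complex)"
        using fun_cong[OF ab(3)] by (auto simp: restrict_def) (metis)
    qed
    then show "\<alpha> = \<beta>" by (simp add: fun_eq_iff)
  qed
  have sub: "(\<lambda>\<alpha>. restrict \<alpha> R) ` ?T \<subseteq> PiE R (\<lambda>_. {..B})" using R(1) by auto
  have fin: "finite (PiE R (\<lambda>_. {..B}))" by (rule finite_PiE) (use finR in auto)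
  have "card ?T \<le> card (PiE R (\<lambda>_. {..B}))"
    using card_mono[OF fin sub] inj by (simp add: card_image)
  also have "\<dots> = Suc B ^ card R" by (simp add: card_PiE[OF finR])
  also have "\<dots> \<le> Suc B ^ fs.dim V" using R(2) by (intro power_increasing) auto
  finally show ?thesis using finite_imageD[OF finite_subset[OF sub fin] inj] by blast
qed

text \<open>Identifies multiplication by a constant with scaling of coefficient functions, so that
  independence of monomials becomes independence in a coordinate space.\<close>

lemma lookup_single_zero_mult:
  "Poly_Mapping.lookup (Poly_Mapping.single 0 c * p) = fscale c (Poly_Mapping.lookup p)"
  by (auto simp: fscale_def fun_eq_iff mult_map_scale_conv_mult[symmetric] map.rep_eq when_def)

text \<open>The single choice \<open>N = K\<close> decides: for d larger than r, the power of
  exponent \<open>Suc r\<close> of \<open>Suc K\<close> would be at most \<open>K\<close> times the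
  power of exponent r.\<close>

lemma le_if_power_le_mult_power:
  assumes "\<And>N :: nat. Suc N ^ d \<le> K * Suc N ^ r"
  shows "d \<le> r"
proof (rule ccontr)
  assume "\<not> d \<le> r"
  then have "Suc K ^ Suc r \<le> Suc K ^ d" by (intro power_increasing) auto
  also have "\<dots> \<le> K * Suc K ^ r" by (rule assms)
  finally show False by simp
qed


lemma prime_chain_length_le_dim:
  fixes S :: "('i \<Rightarrow> nat) set"
  assumes "exponent_monoid S"
    and J: "finite J" and S: "\<And>\<alpha> j. \<alpha> \<in> S \<Longrightarrow> j \<notin> J \<Longrightarrow> \<alpha> j = 0"
    and V: "fs.subspace V" "V \<subseteq> coord_space J" "\<And>\<alpha>. \<alpha> \<in> S \<Longrightarrow> (\<lambda>j. of_nat (\<alpha> j)) \<in> V"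
    and P: "\<forall>i\<le>d. P i \<in> Spec (monoid_algebra S)" "\<forall>i<d. P i \<subset> P (Suc i)"
  shows "d \<le> fs.dim V"
proof -
  interpret exponent_monoid S by fact
  obtain x where x: "\<forall>i<d. x i \<in> P (Suc i) - P i"
  proof -
    have "\<forall>i. \<exists>y. i < d \<longrightarrow> y \<in> P (Suc i) - P i" using P(2) by blast
    then show ?thesis using that by metis
  qed
  have xA: "x i \<in> alg" if "i < d" for i
    using that x P(1) prime_subset[of "P (Suc i)"] by auto
  obtain b where b: "\<forall>i\<in>{..<d}. bounded_exponents J b (x i)"
    using ex_bounded_exponents[OF J finite_lessThan] by blast
  have "Suc N ^ d \<le> Suc (d * b) ^ fs.dim V * Suc N ^ fs.dim V" for N
  proof -
    let ?F = "{ts. set ts \<subseteq> {..N} \<and> length ts = d}"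
    let ?v = "\<lambda>ts. Poly_Mapping.lookup (monomial_from x 0 ts)"
    define T where "T = {\<alpha> \<in> S. \<forall>j\<in>J. \<alpha> j \<le> d * (N * b)}"
    have T: "finite T" "card T \<le> Suc (d * (N * b)) ^ fs.dim V"
      using card_bounded_exponent_vectors[of J S V "d * (N * b)"] J S V unfolding T_def by blast+
    have F: "finite ?F" by (rule finite_lists_length_eq) simp
    have "Poly_Mapping.keys (monomial_from x 0 ts) \<subseteq> T" if "ts \<in> ?F" for ts
    proof -
      have "bounded_exponents J (d * (N * b)) (monomial_from x 0 ts)"
        using bounded_exponents_monomial[of 0 ts J b x N] that b by auto
      moreover have "monomial_from x 0 ts \<in> alg" using that xA by (intro alg_monomial) auto
      ultimately show ?thesis by (auto simp: T_def bounded_exponents_def alg_iff)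
    qed
    \<comment> \<open>The coordinates are now labelled by exponent vectors: the monomials are
      vectors in a space whose dimension is the number of points of \<open>T\<close>.\<close>
    then have sub: "?v ` ?F \<subseteq> coord_space T"
      by (auto simp: coord_space_def in_keys_iff subset_iff)
    have "inj_on ?v ?F \<and> fs.independent (?v ` ?F)"
    proof (rule independent_family[OF F], intro ballI)
      fix c ts assume c: "(\<Sum>ts\<in>?F. fscale (c ts) (?v ts)) = 0" and ts: "ts \<in> ?F"
      \<comment> \<open>A linear relation among the coefficient functions is an equation in the
        algebra; its value 0 lies in \<open>P 0\<close>, the start of the chain.\<close>
      have "(\<Sum>ts\<in>?F. Poly_Mapping.single 0 (c ts) * monomial_from x 0 ts) = 0"
        using fun_cong[OF c]
        by (intro poly_mapping_eqI) (simp add: lookup_sum lookup_single_zero_mult sum_fun_apply)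
      then show "c ts = 0"
        using ts P x prime_zero[of "P 0"]
        by (intro monomials_independent_mod_prime[where l = 0 and m = d and P = P and x = x and N = N]) auto
    qed
    then have "card ?F \<le> card T"
      using independent_card_le_coords[OF T(1) _ sub] by (simp add: card_image)
    then have "Suc N ^ d \<le> card T" by (simp add: card_lists_length_eq)
    also have "\<dots> \<le> Suc (d * (N * b)) ^ fs.dim V" by (rule T(2))
    \<comment> \<open>Separates the side of the cube into a factor independent of \<open>N\<close>
      and the factor \<open>Suc N\<close>, as needed for the comparison of growth.\<close>
    also have "\<dots> \<le> (Suc (d * b) * Suc N) ^ fs.dim V"
      by (intro power_mono) (auto simp: algebra_simps)
    finally show ?thesis by (simp only: power_mult_distrib)
  qed
  then show ?thesis by (rule le_if_power_le_mult_power)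
qed

lemma dim_Spec_monoid_algebra_le:
  fixes S :: "('i \<Rightarrow> nat) set"
  assumes "exponent_monoid S"
    and "finite J" and "\<And>\<alpha> j. \<alpha> \<in> S \<Longrightarrow> j \<notin> J \<Longrightarrow> \<alpha> j = 0"
    and "fs.subspace V" "V \<subseteq> coord_space J" "\<And>\<alpha>. \<alpha> \<in> S \<Longrightarrow> (\<lambda>j. of_nat (\<alpha> j)) \<in> V"
  shows "dim_Spec (monoid_algebra S) \<le> ereal (real (fs.dim V))"
  unfolding dim_Spec_def
proof (rule Sup_least, safe)
  fix d P
  assume "\<forall>i\<le>d. P i \<in> Spec (monoid_algebra S)" "\<forall>i<d. P i \<subset> P (Suc i)"
  then have "d \<le> fs.dim V" using prime_chain_length_le_dim[of S J V d P] assms by blast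
  then show "ereal (real d) \<le> ereal (real (fs.dim V))" by simp
qed

section \<open>Modules of functions and their quotients\<close>

text \<open>One argument covers function spaces, with the identity as \<pi>, and quotients, with the
  coset map. The image of the span is a submodule; conversely, the preimage in \<open>V\<close> of
  any submodule containing the generators is a subspace containing \<open>X\<close>.\<close>

lemma module_span_image:
  fixes M :: "(complex, 'b) module"
  assumes V: "fs.subspace V" "X \<subseteq> V"
    and carr: "carrier M = \<pi> ` V" and zero: "\<zero>\<^bsub>M\<^esub> = \<pi> 0"
    and add: "\<And>x y. \<lbrakk>x \<in> V; y \<in> V\<rbrakk> \<Longrightarrow> \<pi> (x + y) = \<pi> x \<oplus>\<^bsub>M\<^esub> \<pi> y"
    and scale: "\<And>c x. x \<in> V \<Longrightarrow> \<pi> (fscale c x) = c \<odot>\<^bsub>M\<^esub> \<pi> x"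
  shows "module_span M (\<pi> ` X) = \<pi> ` fs.span X"
proof
  have V_add: "x + y \<in> V" if "x \<in> V" "y \<in> V" for x y
    using that V(1) by (simp add: fs.subspace_add)
  have V_neg: "- x \<in> V" if "x \<in> V" for x using that V(1) by (simp add: fs.subspace_neg)
  have V0: "0 \<in> V" using V(1) by (simp add: fs.subspace_0)
  have span_V: "fs.span X \<subseteq> V" by (rule fs.span_minimal[OF V(2,1)])
  \<comment> \<open>No module axioms are assumed for \<open>M\<close>; its additive group structure
    is transported from \<open>V\<close> along \<pi>.\<close>
  interpret G: group "add_monoid M"
  proof (rule groupI)
    fix x y z
    assume "x \<in> carrier (add_monoid M)" "y \<in> carrier (add_monoid M)"
      "z \<in> carrier (add_monoid M)"
    then show "x \<otimes>\<^bsub>add_monoid M\<^esub> y \<otimes>\<^bsub>add_monoid M\<^esub> z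
        = x \<otimes>\<^bsub>add_monoid M\<^esub> (y \<otimes>\<^bsub>add_monoid M\<^esub> z)"
      by (auto simp: carr add[symmetric] V_add add.assoc)
  next
    fix x assume "x \<in> carrier (add_monoid M)"
    then obtain a where a: "a \<in> V" "x = \<pi> a" by (auto simp: carr)
    show "\<one>\<^bsub>add_monoid M\<^esub> \<otimes>\<^bsub>add_monoid M\<^esub> x = x"
      using a V0 by (simp add: zero add[symmetric])
    show "\<exists>y\<in>carrier (add_monoid M). y \<otimes>\<^bsub>add_monoid M\<^esub> x = \<one>\<^bsub>add_monoid M\<^esub>"
      using a V_neg by (intro bexI[of _ "\<pi> (- a)"]) (simp_all add: carr zero add[symmetric])
  qed (auto simp: carr zero add[symmetric] V_add V0)
  have "submodule (\<pi> ` fs.span X) complex_ring M"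
  proof (intro submodule.intro submodule_axioms.intro)
    show "subgroup (\<pi> ` fs.span X) (add_monoid M)"
    proof (rule G.subgroupI)
      show "\<pi> ` fs.span X \<subseteq> carrier (add_monoid M)" using span_V by (auto simp: carr)
      show "\<pi> ` fs.span X \<noteq> {}" using fs.span_zero by blast
      show "inv\<^bsub>add_monoid M\<^esub> a \<in> \<pi> ` fs.span X" if a: "a \<in> \<pi> ` fs.span X" for a
      proof -
        obtain x where x: "x \<in> fs.span X" "a = \<pi> x" using a by blast
        then have xV: "x \<in> V" using span_V by blast
        have "inv\<^bsub>add_monoid M\<^esub> a = \<pi> (- x)"
          by (rule G.inv_equality)
            (use xV x V_neg in \<open>auto simp: carr zero add[symmetric]\<close>)
        then show ?thesis using x by (simp add: fs.span_neg)
      qed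
      show "a \<otimes>\<^bsub>add_monoid M\<^esub> b \<in> \<pi> ` fs.span X"
        if "a \<in> \<pi> ` fs.span X" "b \<in> \<pi> ` fs.span X" for a b
      proof -
        obtain x y where "x \<in> fs.span X" "a = \<pi> x" "y \<in> fs.span X" "b = \<pi> y" using \<open>a \<in> _\<close> \<open>b \<in> _\<close> by blast
        then show ?thesis using span_V by (auto simp: add[symmetric] subset_iff intro!: imageI fs.span_add)
      qed
    qed
    show "c \<odot>\<^bsub>M\<^esub> a \<in> \<pi> ` fs.span X" if a: "a \<in> \<pi> ` fs.span X" for c a
    proof -
      obtain x where "x \<in> fs.span X" "a = \<pi> x" using a by blast
      then show ?thesis using span_V by (auto simp: scale[symmetric] subset_iff intro!: imageI fs.span_scale)
    qed
  qed
  then show "module_span M (\<pi> ` X) \<subseteq> \<pi> ` fs.span X"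
    unfolding module_span_def using fs.span_superset by (intro Inter_lower) blast
  show "\<pi> ` fs.span X \<subseteq> module_span M (\<pi> ` X)"
    unfolding module_span_def
  proof (rule Inter_greatest, clarify)
    fix N x assume N: "submodule N complex_ring M" "\<pi> ` X \<subseteq> N" and x: "x \<in> fs.span X"
    interpret N: submodule N complex_ring M by (rule N(1))
    \<comment> \<open>\<open>N.one_closed\<close> and \<open>N.m_closed\<close> come from the
      additive group, so they give 0 and sums.\<close>
    have "fs.subspace {z \<in> V. \<pi> z \<in> N}"
      using N.one_closed N.m_closed N.smult_closed V0 V_add V(1)
      by (auto simp: fs.subspace_def zero add scale complex_ring_def)
    moreover have "X \<subseteq> {z \<in> V. \<pi> z \<in> N}" using N V by blast
    ultimately show "\<pi> x \<in> N" using fs.span_minimal x by blast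
  qed
qed

lemma module_span_fun_module:
  assumes "fs.subspace V" "X \<subseteq> V"
  shows "module_span (fun_module V) X = fs.span X"
  using module_span_image[OF assms, of "fun_module V" "\<lambda>x. x"] by (simp add: fun_module_def)

lemma module_span_add:
  assumes "x \<in> module_span M X" "y \<in> module_span M X"
  shows "x \<oplus>\<^bsub>M\<^esub> y \<in> module_span M X"
  using assms subgroup.m_closed[of _ "add_monoid M" x y]
  by (auto simp: module_span_def submodule_def)

lemma module_span_smult:
  assumes "x \<in> module_span M X"
  shows "c \<odot>\<^bsub>M\<^esub> x \<in> module_span M X"
  using assms submodule.smult_closed[of _ complex_ring M c x]
  by (auto simp: module_span_def complex_ring_def)

lemma module_span_base: "x \<in> X \<Longrightarrow> x \<in> module_span M X"
  by (auto simp: module_span_def)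

section \<open>Linear equivalence of labelled configurations\<close>

lemma lin_equivalent_sym:
  assumes "lin_equivalent J V v W w"
  shows "lin_equivalent J W w V v"
proof -
  let ?A = "module_span V (v ` J)" and ?B = "module_span W (w ` J)"
  obtain \<phi> where bij: "bij_betw \<phi> ?A ?B"
    and add: "\<And>x y. \<lbrakk>x \<in> ?A; y \<in> ?A\<rbrakk> \<Longrightarrow> \<phi> (x \<oplus>\<^bsub>V\<^esub> y) = \<phi> x \<oplus>\<^bsub>W\<^esub> \<phi> y"
    and scale: "\<And>c x. x \<in> ?A \<Longrightarrow> \<phi> (c \<odot>\<^bsub>V\<^esub> x) = c \<odot>\<^bsub>W\<^esub> \<phi> x"
    and lab: "\<And>j. j \<in> J \<Longrightarrow> \<phi> (v j) = w j"
    using assms unfolding lin_equivalent_def by blast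
  let ?\<psi> = "the_inv_into ?A \<phi>"
  have inj: "inj_on \<phi> ?A" and im: "\<phi> ` ?A = ?B" using bij by (auto simp: bij_betw_def)
  have inv: "?\<psi> (\<phi> x) = x" if "x \<in> ?A" for x by (rule the_inv_into_f_f[OF inj that])
  show ?thesis
    unfolding lin_equivalent_def
  proof (intro exI[of _ ?\<psi>] conjI ballI allI)
    show "bij_betw ?\<psi> ?B ?A" by (rule bij_betw_the_inv_into[OF bij])
    show "?\<psi> (x \<oplus>\<^bsub>W\<^esub> y) = ?\<psi> x \<oplus>\<^bsub>V\<^esub> ?\<psi> y" if "x \<in> ?B" "y \<in> ?B" for x y
    proof -
      obtain a b where "a \<in> ?A" "b \<in> ?A" "x = \<phi> a" "y = \<phi> b" using \<open>x \<in> _\<close> \<open>y \<in> _\<close> im by blast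
      then show ?thesis by (simp add: add[symmetric] inv module_span_add)
    qed
    show "?\<psi> (c \<odot>\<^bsub>W\<^esub> x) = c \<odot>\<^bsub>V\<^esub> ?\<psi> x" if x: "x \<in> ?B" for c x
    proof -
      obtain a where "a \<in> ?A" "x = \<phi> a" using x im by blast
      then show ?thesis by (simp add: scale[symmetric] inv module_span_smult)
    qed
    show "?\<psi> (w j) = v j" if "j \<in> J" for j
      using that lab[OF that] inv[of "v j"] module_span_base[of "v j" "v ` J"] by simp
  qed
qed

lemma lin_equivalent_trans:
  assumes "lin_equivalent J V v W w" "lin_equivalent J W w U u"
  shows "lin_equivalent J V v U u"
proof -
  let ?A = "module_span V (v ` J)" and ?B = "module_span W (w ` J)" and ?C = "module_span U (u ` J)"
  obtain \<phi> where \<phi>: "bij_betw \<phi> ?A ?B"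
     "\<forall>x\<in>?A. \<forall>y\<in>?A. \<phi> (x \<oplus>\<^bsub>V\<^esub> y) = \<phi> x \<oplus>\<^bsub>W\<^esub> \<phi> y"
     "\<forall>c. \<forall>x\<in>?A. \<phi> (c \<odot>\<^bsub>V\<^esub> x) = c \<odot>\<^bsub>W\<^esub> \<phi> x" "\<forall>j\<in>J. \<phi> (v j) = w j"
    using assms(1) unfolding lin_equivalent_def by blast
  obtain \<psi> where \<psi>: "bij_betw \<psi> ?B ?C"
     "\<forall>x\<in>?B. \<forall>y\<in>?B. \<psi> (x \<oplus>\<^bsub>W\<^esub> y) = \<psi> x \<oplus>\<^bsub>U\<^esub> \<psi> y"
     "\<forall>c. \<forall>x\<in>?B. \<psi> (c \<odot>\<^bsub>W\<^esub> x) = c \<odot>\<^bsub>U\<^esub> \<psi> x" "\<forall>j\<in>J. \<psi> (w j) = u j"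
    using assms(2) unfolding lin_equivalent_def by blast
  have mem: "\<phi> x \<in> ?B" if "x \<in> ?A" for x using \<phi>(1) that by (auto simp: bij_betw_def)
  show ?thesis
    unfolding lin_equivalent_def
    using bij_betw_trans[OF \<phi>(1) \<psi>(1)] \<phi>(2-) \<psi>(2-) mem
    by (intro exI[of _ "\<psi> \<circ> \<phi>"]) simp
qed

text \<open>A form of the first isomorphism theorem: two linear surjections from \<open>V\<close>
  with the same fibres have isomorphic images, by sending the image of a vector under \<pi> to its
  image under \<rho>. The vectors \<open>e j\<close> carry the labels.\<close>

lemma lin_equivalent_if_same_fibres:
  assumes M: "module_span M (v ` J) = \<pi> ` V" and N: "module_span N (w ` J) = \<rho> ` V"
    and V: "fs.subspace V"
    and add: "\<And>x y. \<lbrakk>x \<in> V; y \<in> V\<rbrakk> \<Longrightarrow> \<pi> (x + y) = \<pi> x \<oplus>\<^bsub>M\<^esub> \<pi> y"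
      "\<And>x y. \<lbrakk>x \<in> V; y \<in> V\<rbrakk> \<Longrightarrow> \<rho> (x + y) = \<rho> x \<oplus>\<^bsub>N\<^esub> \<rho> y"
    and scale: "\<And>c x. x \<in> V \<Longrightarrow> \<pi> (fscale c x) = c \<odot>\<^bsub>M\<^esub> \<pi> x"
      "\<And>c x. x \<in> V \<Longrightarrow> \<rho> (fscale c x) = c \<odot>\<^bsub>N\<^esub> \<rho> x"
    and fib: "\<And>x y. \<lbrakk>x \<in> V; y \<in> V\<rbrakk> \<Longrightarrow> \<pi> x = \<pi> y \<longleftrightarrow> \<rho> x = \<rho> y"
    and e: "\<And>j. j \<in> J \<Longrightarrow> e j \<in> V \<and> \<pi> (e j) = v j \<and> \<rho> (e j) = w j"
  shows "lin_equivalent J M v N w"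
proof -
  \<comment> \<open>An arbitrary preimage is chosen; equality of the fibres makes the value
    independent of the choice.\<close>
  define \<phi> where "\<phi> = (\<lambda>a. \<rho> (SOME x. x \<in> V \<and> \<pi> x = a))"
  have \<phi>: "\<phi> (\<pi> x) = \<rho> x" if "x \<in> V" for x
  proof -
    have "(SOME y. y \<in> V \<and> \<pi> y = \<pi> x) \<in> V \<and> \<pi> (SOME y. y \<in> V \<and> \<pi> y = \<pi> x) = \<pi> x"
      using that by (intro someI[of "\<lambda>y. y \<in> V \<and> \<pi> y = \<pi> x" x]) simp
    then show ?thesis unfolding \<phi>_def using fib that by blast
  qed
  show ?thesis
    unfolding lin_equivalent_def M N
  proof (intro exI[of _ \<phi>] conjI ballI allI)
    show "bij_betw \<phi> (\<pi> ` V) (\<rho> ` V)"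
      using \<phi> fib by (auto simp: bij_betw_def inj_on_def image_image)
    show "\<phi> (a \<oplus>\<^bsub>M\<^esub> b) = \<phi> a \<oplus>\<^bsub>N\<^esub> \<phi> b" if "a \<in> \<pi> ` V" "b \<in> \<pi> ` V" for a b
      using that by (auto simp: add(1)[symmetric] \<phi> add(2) fs.subspace_add[OF V])
    show "\<phi> (c \<odot>\<^bsub>M\<^esub> a) = c \<odot>\<^bsub>N\<^esub> \<phi> a" if "a \<in> \<pi> ` V" for c a
      using that by (auto simp: scale(1)[symmetric] \<phi> scale(2) fs.subspace_scale[OF V])
    show "\<phi> (v j) = w j" if "j \<in> J" for j using e[OF that] \<phi> by metis
  qed
qed

section \<open>The coset map onto a quotient\<close>

context
  fixes V U :: "('a \<Rightarrow> complex) set"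
  assumes V: "fs.subspace V" and U: "fs.subspace U" "U \<subseteq> V"
begin

abbreviation (input) quotient_class :: "('a \<Rightarrow> complex) \<Rightarrow> ('a \<Rightarrow> complex) set" where
  "quotient_class z \<equiv> U +>\<^bsub>fun_module V\<^esub> z"

lemma quotient_class_eq: "quotient_class z = (\<lambda>u. u + z) ` U"
  by (auto simp: a_r_coset_def' fun_module_def)

lemma quotient_class_eq_iff: "quotient_class z = quotient_class w \<longleftrightarrow> z - w \<in> U"
proof
  assume "quotient_class z = quotient_class w"
  then have "0 + z \<in> (\<lambda>u. u + w) ` U"
    unfolding quotient_class_eq using fs.subspace_0[OF U(1)] by blast
  then show "z - w \<in> U" by auto
next
  assume zw: "z - w \<in> U"
  have "u + z \<in> (\<lambda>u. u + w) ` U" "u + w \<in> (\<lambda>u. u + z) ` U" if "u \<in> U" for u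
    using fs.subspace_add[OF U(1) that zw] fs.subspace_diff[OF U(1) that zw]
    by (auto simp: image_iff algebra_simps intro: bexI[of _ "u + (z - w)"] bexI[of _ "u - (z - w)"])
  then show "quotient_class z = quotient_class w" unfolding quotient_class_eq by blast
qed

lemma quotient_class_add:
  "quotient_class (x + y) = quotient_class x \<oplus>\<^bsub>quot_module (fun_module V) U\<^esub> quotient_class y"
proof -
  have "u + (x + y) \<in> (\<lambda>(a, b). (a + x) + (b + y)) ` (U \<times> U)" if "u \<in> U" for u
    using that fs.subspace_0[OF U(1)] by (intro image_eqI[of _ _ "(u, 0)"]) (simp_all add: algebra_simps)
  moreover have "(a + x) + (b + y) \<in> (\<lambda>u. u + (x + y)) ` U" if "a \<in> U" "b \<in> U" for a b
    using fs.subspace_add[OF U(1) that] by (auto simp: image_iff algebra_simps intro!: bexI[of _ "a + b"])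
  moreover have "quotient_class x \<oplus>\<^bsub>quot_module (fun_module V) U\<^esub> quotient_class y
      = (\<lambda>(a, b). (a + x) + (b + y)) ` (U \<times> U)"
    unfolding quotient_class_eq by (auto simp: quot_module_def set_add_def' fun_module_def)
  ultimately show ?thesis unfolding quotient_class_eq by auto
qed

text \<open>The summand from \<open>U\<close> in the definition of scaling fills up the whole coset,
  also for c = 0, where the multiples alone reduce to 0.\<close>

lemma quotient_class_scale:
  "quotient_class (fscale c x) = c \<odot>\<^bsub>quot_module (fun_module V) U\<^esub> quotient_class x"
proof -
  have "u + fscale c x \<in> (\<lambda>(a, b). a + fscale c (b + x)) ` (U \<times> U)" if "u \<in> U" for u
    using that fs.subspace_0[OF U(1)] by (force simp: image_iff)
  moreover have "a + fscale c (b + x) \<in> (\<lambda>u. u + fscale c x) ` U" if "a \<in> U" "b \<in> U" for a b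
    using fs.subspace_add[OF U(1) that(1) fs.subspace_scale[OF U(1) that(2)], of c]
    by (auto simp: image_iff fs.scale_right_distrib algebra_simps intro!: bexI[of _ "a + fscale c b"])
  moreover have "c \<odot>\<^bsub>quot_module (fun_module V) U\<^esub> quotient_class x
      = (\<lambda>(a, b). a + fscale c (b + x)) ` (U \<times> U)"
    unfolding quotient_class_eq by (auto simp: quot_module_def set_add_def' fun_module_def)
  ultimately show ?thesis unfolding quotient_class_eq by auto
qed

lemma module_span_quotient:
  assumes "X \<subseteq> V"
  shows "module_span (quot_module (fun_module V) U) (quotient_class ` X) = quotient_class ` fs.span X"
proof (rule module_span_image[OF V assms])
  show "carrier (quot_module (fun_module V) U) = quotient_class ` V"
    by (auto simp: quot_module_def A_RCOSETS_def' fun_module_def)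
  show "\<zero>\<^bsub>quot_module (fun_module V) U\<^esub> = quotient_class 0"
    by (auto simp: quot_module_def quotient_class_eq)
qed (rule quotient_class_add quotient_class_scale)+

end

section \<open>Weight configurations\<close>

text \<open>For i in \<open>A\<close>, these functionals are dual to \<open>std_basis\<close>. The
  cut-off is imposed by \<open>dual_space\<close>, whose members vanish outside the
  subspace.\<close>

definition coord_functional :: "'i set \<Rightarrow> 'i \<Rightarrow> ('i \<Rightarrow> complex) \<Rightarrow> complex" where
  "coord_functional A i = (\<lambda>x. if x \<in> coord_space A then x i else 0)"

lemma subspace_dual_space: "fs.subspace (dual_space V)"
  by (auto simp: fs.subspace_def dual_space_def fscale_def algebra_simps)

lemma std_basis_mem: "i \<in> A \<Longrightarrow> std_basis i \<in> coord_space A"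
  by (auto simp: std_basis_def coord_space_def)

text \<open>A member of \<open>dual_space V\<close> is additive only on \<open>V\<close>, not on the
  whole type, so the partial sums have to be kept inside \<open>V\<close>.\<close>

lemma dual_space_sum:
  assumes "f \<in> dual_space V" "fs.subspace V" "finite F" "\<And>i. i \<in> F \<Longrightarrow> v i \<in> V"
  shows "f (\<Sum>i\<in>F. fscale (c i) (v i)) = (\<Sum>i\<in>F. c i * f (v i))"
  using assms(3,4)
proof (induction F)
  case empty
  \<comment> \<open>The value at 0 is obtained from homogeneity with scalar 0.\<close>
  have "f (fscale 0 0) = 0 * f 0"
    using assms fs.subspace_0[OF assms(2)] unfolding dual_space_def by blast
  then show ?case by (simp only: fs.scale_zero_left sum.empty mult_zero_left)
next
  case (insert a F)
  have "(\<Sum>i\<in>F. fscale (c i) (v i)) \<in> V" "fscale (c a) (v a) \<in> V"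
    using insert assms(2) by (auto intro!: fs.subspace_sum fs.subspace_scale)
  then have "f (fscale (c a) (v a) + (\<Sum>i\<in>F. fscale (c i) (v i)))
      = f (fscale (c a) (v a)) + f (\<Sum>i\<in>F. fscale (c i) (v i))"
    using assms(1) unfolding dual_space_def by blast
  moreover have "f (fscale (c a) (v a)) = c a * f (v a)"
    using assms(1) insert.prems unfolding dual_space_def by blast
  ultimately show ?case
    using insert by (simp only: sum.insert[OF insert(1,2)]) simp
qed

lemma dual_coord_space_expand:
  assumes "finite A" "f \<in> dual_space (coord_space A)"
  shows "f = (\<Sum>i\<in>A. fscale (f (std_basis i)) (coord_functional A i))"
proof
  fix x
  show "f x = (\<Sum>i\<in>A. fscale (f (std_basis i)) (coord_functional A i)) x"
  proof (cases "x \<in> coord_space A")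
    case True
    have "f x = f (\<Sum>i\<in>A. fscale (x i) (std_basis i))"
      using coord_space_expand[OF assms(1) True] by simp
    also have "\<dots> = (\<Sum>i\<in>A. x i * f (std_basis i))"
      by (rule dual_space_sum[OF assms(2) subspace_coord_space assms(1)]) (rule std_basis_mem)
    finally show ?thesis
      using True by (simp add: sum_fun_apply fscale_def coord_functional_def mult.commute)
  next
    case False
    then show ?thesis using assms(2)
      by (simp add: sum_fun_apply fscale_def coord_functional_def dual_space_def)
  qed
qed

lemma coord_functional_mem: "coord_functional A i \<in> dual_space (coord_space A)"
  using fs.subspace_add[OF subspace_coord_space] fs.subspace_scale[OF subspace_coord_space]
  by (auto simp: coord_functional_def dual_space_def fscale_def) (auto simp: coord_space_def)

lemma dual_coord_space_span:
  assumes "finite A"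
  shows "dual_space (coord_space A) = fs.span (coord_functional A ` A)"
proof
  show "dual_space (coord_space A) \<subseteq> fs.span (coord_functional A ` A)"
  proof
    fix f assume "f \<in> dual_space (coord_space A)"
    then have "f = (\<Sum>i\<in>A. fscale (f (std_basis i)) (coord_functional A i))"
      by (rule dual_coord_space_expand[OF assms])
    then show "f \<in> fs.span (coord_functional A ` A)"
      by (metis (no_types, lifting) fs.span_base fs.span_scale fs.span_sum imageI)
  qed
  show "fs.span (coord_functional A ` A) \<subseteq> dual_space (coord_space A)"
    by (rule fs.span_minimal[OF _ subspace_dual_space]) (auto simp: coord_functional_mem)
qed

lemma dim_dual_coord_space:
  assumes "finite A"
  shows "fs.dim (dual_space (coord_space A)) = card A"
proof -
  have "inj_on (coord_functional A) A \<and> fs.independent (coord_functional A ` A)"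
  proof (rule independent_family[OF assms], intro ballI)
    fix c i assume c: "(\<Sum>i\<in>A. fscale (c i) (coord_functional A i)) = 0" and i: "i \<in> A"
    have "0 = (\<Sum>j\<in>A. c j * coord_functional A j (std_basis i))"
      using fun_cong[OF c, of "std_basis i"] by (simp add: sum_fun_apply fscale_def)
    also have "(\<Sum>j\<in>A. c j * coord_functional A j (std_basis i)) = (\<Sum>j\<in>A. if j = i then c i else 0)"
      using std_basis_mem[OF i] by (intro sum.cong) (auto simp: coord_functional_def std_basis_def)
    finally show "c i = 0" using i assms by (simp add: sum.delta)
  qed
  then show ?thesis
    by (simp add: dual_coord_space_span[OF assms] fs.dim_eq_card_independent card_image)
qed

lemma span_vanishes:
  assumes "f \<in> fs.span B" "\<And>g. g \<in> B \<Longrightarrow> g x = 0"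
  shows "f x = 0"
proof -
  have "fs.subspace {f. f x = 0}" by (auto simp: fs.subspace_def fscale_def)
  then show ?thesis using fs.span_minimal[of B "{f. f x = 0}"] assms by blast
qed

text \<open>Evaluation maps the coordinate space on \<open>A\<close> linearly into the coordinate
  space on \<open>B\<close>. It is injective because \<open>B\<close> spans all coordinate
  functionals, and both spaces have dimension \<open>card A\<close>, so it is surjective. A preimage
  of the basis vector labelled f is the required vector.\<close>

lemma dual_basis:
  assumes A: "finite A" and B: "fs.independent B" "fs.span B = dual_space (coord_space A)" "f \<in> B"
  obtains x where "x \<in> coord_space A" "f x = 1" "\<And>g. \<lbrakk>g \<in> B; g \<noteq> f\<rbrakk> \<Longrightarrow> g x = 0"
proof -
  have BD: "B \<subseteq> dual_space (coord_space A)" using B fs.span_superset by blast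
  have cardB: "card B = card A"
    using fs.dim_span_eq_card_independent[OF B(1)] dim_dual_coord_space[OF A] B(2) by simp
  have finB: "finite B"
    using independent_card_le_dim[of "coord_functional A ` A" _ B] A B BD
    by (simp add: dual_coord_space_span)
  define ev where "ev = (\<lambda>x (g :: ('a \<Rightarrow> complex) \<Rightarrow> complex). if g \<in> B then g x else 0)"
  have ev_sum: "ev (\<Sum>i\<in>A. fscale (c i) (std_basis i)) = (\<Sum>i\<in>A. fscale (c i) (ev (std_basis i)))" for c
  proof
    fix g
    show "ev (\<Sum>i\<in>A. fscale (c i) (std_basis i)) g = (\<Sum>i\<in>A. fscale (c i) (ev (std_basis i))) g"
      using dual_space_sum[OF _ subspace_coord_space A std_basis_mem, where f = g and c = c] BD
      by (auto simp: ev_def sum_fun_apply fscale_def)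
  qed
  let ?U = "ev ` coord_space A"
  have U: "fs.subspace ?U"
    unfolding fs.subspace_def
  proof (intro conjI ballI allI)
    have "ev 0 = 0" using ev_sum[of "\<lambda>_. 0"] by simp
    then show "0 \<in> ?U" using fs.subspace_0[OF subspace_coord_space] by (metis imageI)
    show "a + b \<in> ?U" if ab: "a \<in> ?U" "b \<in> ?U" for a b
    proof -
      obtain x y where xy: "x \<in> coord_space A" "a = ev x" "y \<in> coord_space A" "b = ev y"
        using ab by blast
      then have "a + b = ev (x + y)" using BD by (auto simp: ev_def fun_eq_iff dual_space_def)
      then show ?thesis using xy fs.subspace_add[OF subspace_coord_space] by blast
    qed
    show "fscale c a \<in> ?U" if a: "a \<in> ?U" for c a
    proof -
      obtain x where x: "x \<in> coord_space A" "a = ev x" using a by blast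
      have "fscale c a g = ev (fscale c x) g" for g
      proof -
        have "fscale c a g = c * ev x g" using x by (simp add: fscale_def)
        moreover have "g (fscale c x) = c * g x" if "g \<in> B"
          using that BD x by (auto simp: dual_space_def)
        ultimately show ?thesis by (simp add: ev_def)
      qed
      then have "fscale c a = ev (fscale c x)" by (rule ext)
      then show ?thesis using x fs.subspace_scale[OF subspace_coord_space] by blast
    qed
  qed
  have UB: "?U \<subseteq> coord_space B" by (auto simp: ev_def coord_space_def)
  let ?w = "\<lambda>i. ev (std_basis i)"
  have w: "inj_on ?w A \<and> fs.independent (?w ` A)"
  proof (rule independent_family[OF A], intro ballI)
    fix c i assume c: "(\<Sum>i\<in>A. fscale (c i) (?w i)) = 0" and i: "i \<in> A"
    define x where "x = (\<Sum>i\<in>A. fscale (c i) (std_basis i))"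
    have x: "x \<in> coord_space A"
      unfolding x_def using subspace_coord_space std_basis_mem
      by (intro fs.subspace_sum fs.subspace_scale)
    have "ev x = 0" using c ev_sum[of c] by (simp add: x_def)
    then have "ev x g = 0" for g by simp
    then have "g x = 0" if "g \<in> B" for g using that by (metis ev_def)
    \<comment> \<open>A vector killed by all of \<open>B\<close> is killed by every coordinate
      functional; this is the injectivity of evaluation.\<close>
    moreover have "coord_functional A i \<in> fs.span B"
      unfolding B(2) by (rule coord_functional_mem)
    ultimately have "coord_functional A i x = 0" by (rule span_vanishes[rotated])
    then have "x i = 0" using x by (simp add: coord_functional_def)
    moreover have "x i = (\<Sum>j\<in>A. if j = i then c i else 0)"
      unfolding x_def sum_fun_apply
      by (intro sum.cong) (auto simp: fscale_def std_basis_def)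
    ultimately show "c i = 0" using i A by (simp add: sum.delta)
  qed
  have wU: "?w ` A \<subseteq> ?U" by (intro image_subsetI imageI std_basis_mem)
  have spanB: "coord_space B \<subseteq> fs.span (std_basis ` B)" by (simp add: coord_space_eq_span[OF finB])
  have "fs.dim (coord_space B) \<le> card (std_basis ` B)"
    by (rule fs.dim_le_card[OF spanB finite_imageI[OF finB]])
  also have "\<dots> \<le> card B" by (rule card_image_le[OF finB])
  also have "\<dots> = card (?w ` A)" using w cardB by (simp add: card_image)
  also have "\<dots> \<le> fs.dim ?U"
    by (rule conjunct2[OF independent_card_le_dim[OF finite_imageI[OF finB]
          subset_trans[OF UB spanB] conjunct2[OF w] wU]])
  finally have "?U = coord_space B"
    by (rule subspace_eq_if_dim_le[OF finite_imageI[OF finB] spanB U UB])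
  then have "std_basis f \<in> ?U" using std_basis_mem[OF B(3)] by simp
  then obtain x where x: "x \<in> coord_space A" "std_basis f = ev x" by (rule imageE)
  have eval: "g x = (if g = f then 1 else 0)" if "g \<in> B" for g
    using that fun_cong[OF x(2), of g] by (simp add: ev_def std_basis_def)
  show thesis by (rule that[OF x(1)]) (simp_all add: eval B(3))
qed

section \<open>The residual map and the dimension of its kernel\<close>

lemma residual_map_add:
  "residual_map k n \<Lambda> I (x + y) = residual_map k n \<Lambda> I x + residual_map k n \<Lambda> I y"
  by (simp add: residual_map_def fs.scale_left_distrib sum.distrib)

lemma residual_map_scale:
  "residual_map k n \<Lambda> I (fscale c x) = fscale c (residual_map k n \<Lambda> I x)"
  by (simp add: residual_map_def fs.scale_sum_right) (simp add: fscale_def mult.assoc)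

lemma subspace_residual_kernel: "fs.subspace (residual_kernel k n \<Lambda> I)"
  using subspace_coord_space[of "{1..n} - I"] residual_map_scale[of k n \<Lambda> I 0 0]
  by (simp add: fs.subspace_def residual_kernel_def residual_map_add residual_map_scale)

text \<open>Extend a basis \<open>B\<close> of the span of the support weights to a basis
  \<open>E\<close> of the full dual, using weights only. The k - r_I new elements carry labels in a
  set \<open>C\<close> outside \<open>I\<close>, and their restrictions to the common kernel are
  independent. Hence a kernel vector is determined by its coordinates in J - C, of which there are
  (n - |I|) - (k - r_I). Real numbers avoid truncated subtraction.\<close>

lemma dim_residual_kernel_le:
  assumes sp: "spanning_weights k n \<Lambda>" and I: "I \<subseteq> {1..n}"
  shows "real (fs.dim (residual_kernel k n \<Lambda> I))
      \<le> (real n - real k) - (real (card I) - real (support_rank \<Lambda> I))"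
proof -
  let ?J = "{1..n} - I"
  have sp': "fs.span (\<Lambda> ` {1..n}) = dual_space (coord_space {1..k})"
    using sp by (simp add: spanning_weights_def)
  obtain B where B: "B \<subseteq> \<Lambda> ` I" "fs.independent B" "\<Lambda> ` I \<subseteq> fs.span B" "card B = fs.dim (\<Lambda> ` I)"
    using fs.basis_exists[of "\<Lambda> ` I"] by blast
  have BN: "B \<subseteq> \<Lambda> ` {1..n}" using B(1) I by blast
  obtain E where E: "B \<subseteq> E" "E \<subseteq> \<Lambda> ` {1..n}" "fs.independent E" "\<Lambda> ` {1..n} \<subseteq> fs.span E"
    using fs.maximal_independent_subset_extend[OF BN B(2)] by metis
  have spE: "fs.span E = dual_space (coord_space {1..k})"
    unfolding sp'[symmetric] using E(2,4) by (simp add: fs.span_mono fs.span_minimal subset_antisym)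
  have finE: "finite E" using E(2) by (rule finite_subset) simp
  have cardE: "card E = k"
    using fs.dim_span_eq_card_independent[OF E(3)] dim_dual_coord_space[of "{1..k}"] spE by simp
  have "\<exists>j\<in>?J. \<Lambda> j = f" if f: "f \<in> E - B" for f
  proof -
    obtain j where j: "j \<in> {1..n}" "\<Lambda> j = f" using f E(2) by blast
    \<comment> \<open>A support weight already lies in the span of \<open>B\<close>, hence in that
      of \<open>E - {f}\<close>, against the independence of \<open>E\<close>.\<close>
    have "j \<notin> I"
    proof
      assume "j \<in> I"
      then have "f \<in> fs.span (E - {f})"
        using B(3) j f E(1) fs.span_mono[of B "E - {f}"] by blast
      then show False using E(3) f unfolding fs.dependent_def by blast
    qed
    then show ?thesis using j by blast
  qed
  \<comment> \<open>Several labels may carry the same weight; \<open>g\<close> selects one label for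
    each new basis element and is injective since \<Lambda> inverts it.\<close>
  then obtain g where g: "\<And>f. f \<in> E - B \<Longrightarrow> g f \<in> ?J \<and> \<Lambda> (g f) = f" by metis
  define C where "C = g ` (E - B)"
  have inj: "inj_on g (E - B)" using g by (metis inj_onI)
  have CJ: "C \<subseteq> ?J" using g by (auto simp: C_def)
  have cardC: "card C + support_rank \<Lambda> I = k"
    using card_Diff_subset[OF finite_subset[OF E(1) finE] E(1)] card_mono[OF finE E(1)] cardE B(4)
    by (simp add: C_def card_image[OF inj] support_rank_def)
  have "fs.dim (residual_kernel k n \<Lambda> I) \<le> card (?J - C)"
  proof (rule dim_le_card_if_restriction_injective[OF subspace_residual_kernel])
    fix z assume z: "z \<in> residual_kernel k n \<Lambda> I" "\<forall>j\<in>?J - C. z j = 0"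
    \<comment> \<open>Evaluate at a vector dual to \<open>\<Lambda> c\<close>: it lies in the common kernel since \<open>B\<close> spans the weights of \<open>I\<close>.\<close>
    have "z c = 0" if c: "c \<in> C" for c
    proof -
      have f: "\<Lambda> c \<in> E" "\<Lambda> c \<notin> B" using c g by (auto simp: C_def)
      obtain x where x: "x \<in> coord_space {1..k}" "\<Lambda> c x = 1"
          "\<And>h. \<lbrakk>h \<in> E; h \<noteq> \<Lambda> c\<rbrakk> \<Longrightarrow> h x = 0"
        using dual_basis[OF _ E(3) spE f(1)] by (metis finite_atLeastAtMost)
      have "\<Lambda> i x = 0" if "i \<in> I" for i
        using that B(3) E(1) f x(3) by (intro span_vanishes[of "\<Lambda> i" B]) blast+
      then have xh: "x \<in> common_kernel k \<Lambda> I" using x by (simp add: common_kernel_def)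
      have "0 = residual_map k n \<Lambda> I z x" using z by (simp add: residual_kernel_def)
      also have "\<dots> = (\<Sum>j\<in>?J. z j * \<Lambda> j x)"
        using xh by (simp add: residual_map_def sum_fun_apply fscale_def residual_weight_def
            restrict_functional_def)
      \<comment> \<open>Outside \<open>C\<close> the coordinates of z vanish; for another j in
        \<open>C\<close> the weight is an element of \<open>E\<close> different from that of c and
        vanishes at x.\<close>
      also have "\<dots> = (\<Sum>j\<in>?J. if j = c then z c else 0)"
      proof (rule sum.cong[OF refl])
        fix j assume j: "j \<in> ?J"
        show "z j * \<Lambda> j x = (if j = c then z c else 0)"
        proof (cases "j \<in> C \<and> j \<noteq> c")
          case True
          then have "\<Lambda> j \<in> E" "\<Lambda> j \<noteq> \<Lambda> c" using c g by (auto simp: C_def)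
          then show ?thesis using x(3) True by simp
        next
          case False
          then show ?thesis using z(2) j x(2) by (cases "j = c") auto
        qed
      qed
      also have "\<dots> = z c" using subsetD[OF CJ c] by (subst sum.delta) auto
      finally show ?thesis by simp
    qed
    moreover have "z j = 0" if "j \<notin> ?J" for j
      using z(1) that unfolding residual_kernel_def coord_space_def by blast
    ultimately have "z j = 0" for j using z(2) by blast
    then show "z = 0" by (simp add: fun_eq_iff)
  qed simp
  also have "card (?J - C) = card ?J - card C" using CJ by (simp add: card_Diff_subset finite_subset)
  also have "card ?J = n - card I" using I by (simp add: card_Diff_subset finite_subset)
  finally show ?thesis
    using cardC card_mono[OF _ CJ] card_mono[OF _ I] I
    by (simp add: card_Diff_subset finite_subset)
qed

section \<open>The invariant monoid, its lattice and the dimension of its spectrum\<close>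

lemma exponent_monoid_invariant_monoid: "exponent_monoid (invariant_monoid k n \<Lambda> I)"
proof
  have "(\<lambda>j. of_nat ((0 :: nat \<Rightarrow> nat) j)) = (0 :: nat \<Rightarrow> complex)" by (simp add: fun_eq_iff)
  then show "0 \<in> invariant_monoid k n \<Lambda> I"
    using fs.subspace_0[OF subspace_residual_kernel[of k n \<Lambda> I]]
    by (simp add: invariant_monoid_def residual_kernel_def)
  fix a b assume ab: "a \<in> invariant_monoid k n \<Lambda> I" "b \<in> invariant_monoid k n \<Lambda> I"
  have "(\<lambda>j. of_nat ((a + b) j)) = (\<lambda>j. of_nat (a j)) + (\<lambda>j. of_nat (b j) :: complex)"
    by (simp add: fun_eq_iff)
  then show "a + b \<in> invariant_monoid k n \<Lambda> I"
    using ab by (simp add: invariant_monoid_def residual_map_add)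
qed

lemma invariant_monoid_subset_kernel:
  "\<alpha> \<in> invariant_monoid k n \<Lambda> I \<Longrightarrow> (\<lambda>j. of_nat (\<alpha> j)) \<in> residual_kernel k n \<Lambda> I"
  by (simp add: invariant_monoid_def residual_kernel_def coord_space_def)

lemma invariant_monoid_subset_lattice_complex:
  assumes "\<alpha> \<in> invariant_monoid k n \<Lambda> I"
  shows "(\<lambda>j. of_nat (\<alpha> j)) \<in> invariant_lattice_complex k n \<Lambda> I"
proof -
  have "(\<lambda>j. int (\<alpha> j)) \<in> invariant_lattice k n \<Lambda> I"
    unfolding invariant_lattice_def using assms by (intro group_closure.base) simp
  then show ?thesis
    unfolding invariant_lattice_complex_def by (intro fs.span_base) force
qed

lemma invariant_lattice_complex_subset_kernel:
  "invariant_lattice_complex k n \<Lambda> I \<subseteq> residual_kernel k n \<Lambda> I"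
  unfolding invariant_lattice_complex_def
proof (rule fs.span_minimal[OF _ subspace_residual_kernel], clarify)
  fix m assume "m \<in> invariant_lattice k n \<Lambda> I"
  then show "(\<lambda>j. of_int (m j)) \<in> residual_kernel k n \<Lambda> I"
    unfolding invariant_lattice_def
  proof (induction rule: group_closure.induct)
    \<comment> \<open>The generators of \<open>group_closure\<close> include 0, which accounts for
      the separate appeal to \<open>fs.subspace_0\<close>.\<close>
    case (base s)
    then show ?case
      using fs.subspace_0[OF subspace_residual_kernel[of k n \<Lambda> I]] invariant_monoid_subset_kernel
      by (auto simp: zero_fun_def)
  next
    case (diff s t)
    have "(\<lambda>j. of_int ((s - t) j)) = (\<lambda>j. of_int (s j)) - (\<lambda>j. of_int (t j) :: complex)"
      by (simp add: fun_eq_iff)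
    then show ?case using fs.subspace_diff[OF subspace_residual_kernel diff.IH] by simp
  qed
qed

lemma subspace_invariant_lattice_complex: "fs.subspace (invariant_lattice_complex k n \<Lambda> I)"
  unfolding invariant_lattice_complex_def by (rule fs.subspace_span)

lemma residual_kernel_subset_coord_space: "residual_kernel k n \<Lambda> I \<subseteq> coord_space ({1..n} - I)"
  by (auto simp: residual_kernel_def)

text \<open>The bound uses the complexified lattice and not merely the kernel that contains it: this
  is what makes the two coincide in the extremal case.\<close>

lemma dim_Q_le: "dim_Q k n \<Lambda> I \<le> ereal (real (fs.dim (invariant_lattice_complex k n \<Lambda> I)))"
  unfolding dim_Q_def
proof (rule dim_Spec_monoid_algebra_le[where J = "{1..n} - I"])
  show "exponent_monoid (invariant_monoid k n \<Lambda> I)" by (rule exponent_monoid_invariant_monoid)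
  show "fs.subspace (invariant_lattice_complex k n \<Lambda> I)" by (rule subspace_invariant_lattice_complex)
  show "invariant_lattice_complex k n \<Lambda> I \<subseteq> coord_space ({1..n} - I)"
    by (rule subset_trans[OF invariant_lattice_complex_subset_kernel residual_kernel_subset_coord_space])
  show "\<alpha> j = 0" if "\<alpha> \<in> invariant_monoid k n \<Lambda> I" "j \<notin> {1..n} - I" for \<alpha> j
    using that unfolding invariant_monoid_def by blast
  show "(\<lambda>j. of_nat (\<alpha> j)) \<in> invariant_lattice_complex k n \<Lambda> I"
    if "\<alpha> \<in> invariant_monoid k n \<Lambda> I" for \<alpha>
    by (rule invariant_monoid_subset_lattice_complex[OF that])
qed simp

lemma residual_kernel_span:
  "residual_kernel k n \<Lambda> I \<subseteq> fs.span (std_basis ` ({1..n} - I))"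
proof -
  have "coord_space ({1..n} - I) = fs.span (std_basis ` ({1..n} - I))"
    by (rule coord_space_eq_span) simp
  then show ?thesis using residual_kernel_subset_coord_space[of k n \<Lambda> I] by (simp only:)
qed

lemma dim_invariant_lattice_complex_le:
  "fs.dim (invariant_lattice_complex k n \<Lambda> I) \<le> fs.dim (residual_kernel k n \<Lambda> I)"
proof -
  obtain B where B: "B \<subseteq> invariant_lattice_complex k n \<Lambda> I" "fs.independent B"
    "card B = fs.dim (invariant_lattice_complex k n \<Lambda> I)"
    by (rule fs.basis_exists)
  have "B \<subseteq> residual_kernel k n \<Lambda> I"
    by (rule subset_trans[OF B(1) invariant_lattice_complex_subset_kernel])
  then show ?thesis
    unfolding B(3)[symmetric]
    by (intro conjunct2[OF independent_card_le_dim[OF _ residual_kernel_span B(2)]]) simp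
qed

section \<open>Independence of the support weights\<close>

lemma support_rank_le_card:
  assumes "finite I"
  shows "support_rank \<Lambda> I \<le> card I"
  unfolding support_rank_def fs.dim_span
  by (rule order_trans[OF fs.dim_le_card[OF fs.span_superset finite_imageI[OF assms]]
        card_image_le[OF assms]])

text \<open>A basis chosen among the weights already has \<open>card I\<close> elements, so it
  exhausts them and no weight is repeated. Together the two conclusions express independence of the
  labelled family.\<close>

lemma independent_if_support_rank_eq_card:
  assumes "finite I" "support_rank \<Lambda> I = card I"
  shows "inj_on \<Lambda> I \<and> fs.independent (\<Lambda> ` I)"
proof -
  obtain B where B: "B \<subseteq> \<Lambda> ` I" "fs.independent B" "card B = fs.dim (\<Lambda> ` I)"
    by (rule fs.basis_exists)
  have "card B = card I" using B assms by (simp add: support_rank_def)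
  moreover have "card B \<le> card (\<Lambda> ` I)" by (rule card_mono[OF finite_imageI[OF assms(1)] B(1)])
  moreover have "card (\<Lambda> ` I) \<le> card I" by (rule card_image_le[OF assms(1)])
  ultimately have eq: "card B = card (\<Lambda> ` I)" "card (\<Lambda> ` I) = card I" by simp_all
  then show ?thesis
    using B card_subset_eq[of "\<Lambda> ` I" B] eq_card_imp_inj_on[OF assms(1)] assms(1) by simp
qed

section \<open>Comparison of the quotient with the residual weights\<close>

lemma residual_weight_mem_dual:
  assumes "\<Lambda> j \<in> dual_space (coord_space {1..k})"
    and "\<And>i. i \<in> I \<Longrightarrow> \<Lambda> i \<in> dual_space (coord_space {1..k})"
  shows "residual_weight k \<Lambda> I j \<in> dual_space (common_kernel k \<Lambda> I)"
proof -
  let ?V = "coord_space {1..k}" and ?h = "common_kernel k \<Lambda> I"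
  have "x + y \<in> ?h" if "x \<in> ?h" "y \<in> ?h" for x y
    using that assms(2) fs.subspace_add[OF subspace_coord_space]
    by (auto simp: common_kernel_def dual_space_def)
  moreover have "fscale c x \<in> ?h" if "x \<in> ?h" for c x
    using that assms(2) fs.subspace_scale[OF subspace_coord_space]
    by (auto simp: common_kernel_def dual_space_def)
  moreover have "x \<in> ?V" if "x \<in> ?h" for x using that by (simp add: common_kernel_def)
  ultimately show ?thesis
    using assms(1)
    by (simp add: residual_weight_def restrict_functional_def dual_space_def del: One_nat_def)
qed

text \<open>Once the complexified lattice is the kernel, the coset map and the residual map have the
  same fibres on the coordinate space, and both send \<open>std_basis j\<close> to the vector
  labelled j.\<close>

lemma lin_equivalent_quotient_residual:
  assumes sp: "spanning_weights k n \<Lambda>" and I: "I \<subseteq> {1..n}"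
    and eq: "invariant_lattice_complex k n \<Lambda> I = residual_kernel k n \<Lambda> I"
  shows "lin_equivalent ({1..n} - I) (quotient_W k n \<Lambda> I) (basis_class k n \<Lambda> I)
    (residual_dual k \<Lambda> I) (residual_weight k \<Lambda> I)"
proof -
  let ?J = "{1..n} - I" and ?U = "residual_kernel k n \<Lambda> I"
  let ?V = "coord_space ?J"
  let ?\<pi> = "\<lambda>z. ?U +>\<^bsub>fun_module ?V\<^esub> z"
  have W: "quotient_W k n \<Lambda> I = quot_module (fun_module ?V) ?U"
    and bc: "basis_class k n \<Lambda> I = (\<lambda>j. ?\<pi> (std_basis j))"
    unfolding quotient_W_def basis_class_def eq by (rule refl)+
  note U = subspace_coord_space[of ?J] subspace_residual_kernel[of k n \<Lambda> I]
    residual_kernel_subset_coord_space[of k n \<Lambda> I]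
  have V: "?V = fs.span (std_basis ` ?J)" by (rule coord_space_eq_span) simp
  have sub: "std_basis ` ?J \<subseteq> ?V" by (intro image_subsetI std_basis_mem)
  have lin: "Vector_Spaces.linear fscale fscale (residual_map k n \<Lambda> I)"
    by (simp add: Vector_Spaces.linear_iff fs.vector_space_axioms residual_map_add residual_map_scale)
  have rw: "residual_weight k \<Lambda> I ` ?J = residual_map k n \<Lambda> I ` std_basis ` ?J"
    unfolding image_image by (intro image_cong refl) (rule residual_map_std_basis[symmetric])
  show ?thesis
  proof (rule lin_equivalent_if_same_fibres[where V = ?V and \<pi> = ?\<pi> and \<rho> = "residual_map k n \<Lambda> I"
        and e = std_basis])
    show "module_span (quotient_W k n \<Lambda> I) (basis_class k n \<Lambda> I ` ?J) = ?\<pi> ` ?V"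
      using module_span_quotient[OF U sub] unfolding W bc V[symmetric] image_image .
    have "module_span (residual_dual k \<Lambda> I) (residual_weight k \<Lambda> I ` ?J)
        = fs.span (residual_weight k \<Lambda> I ` ?J)"
      unfolding residual_dual_def
    proof (rule module_span_fun_module[OF subspace_dual_space], clarify)
      fix j assume "j \<in> {1..n}" "j \<notin> I"
      then show "residual_weight k \<Lambda> I j \<in> dual_space (common_kernel k \<Lambda> I)"
        using sp I by (intro residual_weight_mem_dual) (auto simp: spanning_weights_def)
    qed
    also have "\<dots> = residual_map k n \<Lambda> I ` ?V"
      unfolding rw V by (rule fp.linear_span_image[OF lin])
    finally show "module_span (residual_dual k \<Lambda> I) (residual_weight k \<Lambda> I ` ?J)
        = residual_map k n \<Lambda> I ` ?V" .
    show "?\<pi> x = ?\<pi> y \<longleftrightarrow> residual_map k n \<Lambda> I x = residual_map k n \<Lambda> I y"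
      if "x \<in> ?V" "y \<in> ?V" for x y
    proof -
      have "?\<pi> x = ?\<pi> y \<longleftrightarrow> x - y \<in> ?U" by (rule quotient_class_eq_iff[OF U])
      also have "\<dots> \<longleftrightarrow> residual_map k n \<Lambda> I (x - y) = 0"
        using fs.subspace_diff[OF U(1) that] unfolding residual_kernel_def by blast
      also have "\<dots> \<longleftrightarrow> residual_map k n \<Lambda> I x = residual_map k n \<Lambda> I y"
        unfolding fp.linear_diff[OF lin] by (rule eq_iff_diff_eq_0[symmetric])
      finally show ?thesis .
    qed
    show "std_basis j \<in> ?V \<and> ?\<pi> (std_basis j) = basis_class k n \<Lambda> I j
        \<and> residual_map k n \<Lambda> I (std_basis j) = residual_weight k \<Lambda> I j" if "j \<in> ?J" for j
      unfolding bc by (intro conjI std_basis_mem residual_map_std_basis that refl)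
    show "?\<pi> (x + y) = ?\<pi> x \<oplus>\<^bsub>quotient_W k n \<Lambda> I\<^esub> ?\<pi> y" for x y
      unfolding W by (rule quotient_class_add[OF U])
    show "?\<pi> (fscale c x) = c \<odot>\<^bsub>quotient_W k n \<Lambda> I\<^esub> ?\<pi> x" for c x
      unfolding W by (rule quotient_class_scale[OF U])
    show "fs.subspace ?V" by (rule U(1))
  qed (simp_all only: residual_map_add residual_map_scale residual_dual_def fun_module_def
      module.simps ring.simps)
qed

section \<open>The extremal case\<close>

lemma maximal_dim_Q:
  assumes sp: "spanning_weights k n \<Lambda>" and I: "I \<subseteq> {1..n}"
    and dim: "dim_Q k n \<Lambda> I = ereal (real n - real k)"
  shows "support_rank \<Lambda> I = card I"
    and "invariant_lattice_complex k n \<Lambda> I = residual_kernel k n \<Lambda> I"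
proof -
  have r: "support_rank \<Lambda> I \<le> card I" using I finite_subset by (intro support_rank_le_card) blast
  have le: "real n - real k \<le> real (fs.dim (invariant_lattice_complex k n \<Lambda> I))"
    using dim_Q_le[of k n \<Lambda> I] by (simp add: dim)
  then show "support_rank \<Lambda> I = card I"
    using dim_residual_kernel_le[OF sp I] dim_invariant_lattice_complex_le[of k n \<Lambda> I] r by linarith
  show "invariant_lattice_complex k n \<Lambda> I = residual_kernel k n \<Lambda> I"
  proof (rule subspace_eq_if_dim_le[OF _ residual_kernel_span subspace_invariant_lattice_complex
        invariant_lattice_complex_subset_kernel])
    show "fs.dim (residual_kernel k n \<Lambda> I) \<le> fs.dim (invariant_lattice_complex k n \<Lambda> I)"
      using le dim_residual_kernel_le[OF sp I] r by linarith
  qed simp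
qed

theorem proposition8p1:
  fixes k n :: nat
    and \<Lambda> :: "nat \<Rightarrow> (nat \<Rightarrow> complex) \<Rightarrow> complex"
    and I :: "nat set"
  assumes "spanning_weights k n \<Lambda>"
    and "I \<subseteq> {1..n}"
  shows "dim_Q k n \<Lambda> I
           \<le> ereal ((real n - real k) - (real (card I) - real (support_rank \<Lambda> I)))
       \<and> (real n - real k) - (real (card I) - real (support_rank \<Lambda> I)) \<le> real n - real k
       \<and> (dim_Q k n \<Lambda> I = ereal (real n - real k) \<longrightarrow>
            support_rank \<Lambda> I = card I
          \<and> invariant_lattice_complex k n \<Lambda> I = residual_kernel k n \<Lambda> I
          \<and> (inj_on \<Lambda> I \<and> fs.independent (\<Lambda> ` I))
          \<and> lin_equivalent ({1..n} - I)
              (quotient_W k n \<Lambda> I) (basis_class k n \<Lambda> I)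
              (residual_dual k \<Lambda> I) (residual_weight k \<Lambda> I)
          \<and> (\<forall>k' n' \<Lambda>' I'.
               spanning_weights k' n' \<Lambda>' \<and> I' \<subseteq> {1..n'} \<and> {1..n'} - I' = {1..n} - I
             \<and> dim_Q k' n' \<Lambda>' I' = ereal (real n' - real k')
             \<and> lin_equivalent ({1..n} - I)
                 (quotient_W k n \<Lambda> I) (basis_class k n \<Lambda> I)
                 (quotient_W k' n' \<Lambda>' I') (basis_class k' n' \<Lambda>' I')
             \<longrightarrow> lin_equivalent ({1..n} - I)
                 (residual_dual k \<Lambda> I) (residual_weight k \<Lambda> I)
                 (residual_dual k' \<Lambda>' I') (residual_weight k' \<Lambda>' I')))"
proof (intro conjI impI allI)
  have fin: "finite I" using assms(2) finite_subset by blast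
  note r = support_rank_le_card[OF fin, of \<Lambda>]
  show "(real n - real k) - (real (card I) - real (support_rank \<Lambda> I)) \<le> real n - real k"
    using r by simp
  have "real (fs.dim (invariant_lattice_complex k n \<Lambda> I))
      \<le> (real n - real k) - (real (card I) - real (support_rank \<Lambda> I))"
    using dim_residual_kernel_le[OF assms] dim_invariant_lattice_complex_le[of k n \<Lambda> I] by linarith
  then show "dim_Q k n \<Lambda> I
      \<le> ereal ((real n - real k) - (real (card I) - real (support_rank \<Lambda> I)))"
    using dim_Q_le[of k n \<Lambda> I] by (meson ereal_less_eq(3) order_trans)
  assume dim: "dim_Q k n \<Lambda> I = ereal (real n - real k)"
  note max = maximal_dim_Q[OF assms dim]
  show "support_rank \<Lambda> I = card I"
    "invariant_lattice_complex k n \<Lambda> I = residual_kernel k n \<Lambda> I"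
    by (rule max)+
  show "inj_on \<Lambda> I" "fs.independent (\<Lambda> ` I)"
    using independent_if_support_rank_eq_card[OF fin max(1)] by blast+
  show eqv: "lin_equivalent ({1..n} - I) (quotient_W k n \<Lambda> I) (basis_class k n \<Lambda> I)
      (residual_dual k \<Lambda> I) (residual_weight k \<Lambda> I)"
    by (rule lin_equivalent_quotient_residual[OF assms max(2)])
  \<comment> \<open>That the classes determine the residual configuration means that data with
    equivalent classes have equivalent residual weights. Each residual configuration is equivalent
    to the classes in its own quotient, and the three equivalences are composed.\<close>
  fix k' n' \<Lambda>' I'
  assume asm: "spanning_weights k' n' \<Lambda>' \<and> I' \<subseteq> {1..n'} \<and> {1..n'} - I' = {1..n} - I
      \<and> dim_Q k' n' \<Lambda>' I' = ereal (real n' - real k')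
      \<and> lin_equivalent ({1..n} - I)
          (quotient_W k n \<Lambda> I) (basis_class k n \<Lambda> I)
          (quotient_W k' n' \<Lambda>' I') (basis_class k' n' \<Lambda>' I')"
  then have "lin_equivalent ({1..n'} - I') (quotient_W k' n' \<Lambda>' I') (basis_class k' n' \<Lambda>' I')
      (residual_dual k' \<Lambda>' I') (residual_weight k' \<Lambda>' I')"
    by (intro lin_equivalent_quotient_residual maximal_dim_Q(2)) auto
  then have "lin_equivalent ({1..n} - I) (quotient_W k' n' \<Lambda>' I') (basis_class k' n' \<Lambda>' I')
      (residual_dual k' \<Lambda>' I') (residual_weight k' \<Lambda>' I')"
    using asm by simp
  then show "lin_equivalent ({1..n} - I)
      (residual_dual k \<Lambda> I) (residual_weight k \<Lambda> I)
      (residual_dual k' \<Lambda>' I') (residual_weight k' \<Lambda>' I')"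
    using asm lin_equivalent_sym[OF eqv] lin_equivalent_trans by metis
qed

end
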